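(* Let $U:\mathcal{E}\to\mathcal{B}$ be a bifibration satisfying the Beck-Chevalley condition, where $\mathcal{B}$ has binary products, $U$ has a truth functor $K$, and the equality functor $Eq=\Sigma_\delta K:\mathcal{B}\to Rel(\mathcal{E})$ has a left adjoint $Q$ (so that $Rel(U):Rel(\mathcal{E})\to\mathcal{B}$ is a relational QCE). Let $F:\mathcal{B}\to\mathcal{B}$ be a functor having a final coalgebra with carrier $\nu F$. Then there exists an $Eq$-preserving lifting of $F$ with respect to $Rel(U)$ which defines a sound coinduction rule for $\nu F$.
   Context: For a functor $U:\mathcal{E}\to\mathcal{B}$, a morphism $g:Q\to P$ in $\mathcal{E}$ is cartesian above $f:X\to Y$ if $Ug=f$ and for every $g':Q'\to P$ with $Ug'=fv$ for some $v:UQ'\to X$ there is a unique $h:Q'\to Q$ with $Uh=v$ and $gh=g'$. $U$ is a fibration if for every object $P$ of $\mathcal{E}$ and every $f:X\to UP$ there is a cartesian morphism above $f$ with codomain $P$; its domain is written $f^*P$, giving reindexing functors $f^*:\mathcal{E}_Y\to\mathcal{E}_X$ between fibres ($\mathcal{E}_X$ is the subcategory of objects above $X$ and morphisms above $id_X$). Opcartesian morphisms and opfibrations are defined dually (i.e. $U^{op}$ is a fibration); the opreindexing functor $\Sigma_f:\mathcal{E}_X\to\mathcal{E}_Y$ is left adjoint to $f^*$. A bifibration is a functor that is both a fibration and an opfibration. $U$ satisfies the Beck-Chevalley condition if for every pullback square $f t=g s$ (with $t:A\to B$, $s:A\to C$, $f:B\to D$, $g:C\to D$) the canonical natural transformation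 $\Sigma_s t^*\to g^*\Sigma_f$ (built from the unit of $\Sigma_f\dashv f^*$ and the counit of $\Sigma_s\dashv s^*$) is an isomorphism. $U$ has a truth functor if each fibre $\mathcal{E}_X$ has a terminal object and reindexing preserves them; the truth functor $K:\mathcal{B}\to\mathcal{E}$ sends $X$ to the terminal object of $\mathcal{E}_X$. The relations fibration $Rel(U):Rel(\mathcal{E})\to\mathcal{B}$ is the pullback (change of base) of $U$ along $\Delta:\mathcal{B}\to\mathcal{B}$, $X\mapsto X\times X$; its fibre above $X$ is $\mathcal{E}_{X\times X}$. With $\delta_X:X\to X\times X$ the diagonal, the equality functor $Eq:\mathcal{B}\to Rel(\mathcal{E})$ sends $X$ to $\Sigma_{\delta_X}KX$ (above $X$ in $Rel(\mathcal{E})$), and a morphism $f$ to the unique morphism above $f\times f$ induced by naturality of $\delta$ and opcartesianness. A lifting of $F$ with respect to $Rel(U)$ is a functor $\check F:Rel(\mathcal{E})\to Rel(\mathcal{E})$ with $Rel(U)\check F=F\,Rel(U)$; it is $Eq$-preserving if $Eq\,F\cong \check F\,Eq$. Such a lifting defines a sound coinduction rule for $\nu F$ if the functor from $F$-coalgebras to $\check F$-coalgebras sending $\alpha:X\to FX$ to $Eq\,X\xrightarrow{Eq\,\alpha}Eq\,FX\cong\check F\,Eq\,X$ preserves terminal objects. *)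

theory Defs
  imports Main
begin

section \<open>Categories, functors, natural transformations\<close>

record ('o, 'a) cat =
  Obj :: "'o set"
  Arr :: "'a set"
  Dom :: "'a \<Rightarrow> 'o"
  Cod :: "'a \<Rightarrow> 'o"
  Idn :: "'o \<Rightarrow> 'a"
  Cmp :: "'a \<Rightarrow> 'a \<Rightarrow> 'a"  (infixr "\<cdot>\<index>" 70)

definition Hom :: "('o, 'a) cat \<Rightarrow> 'o \<Rightarrow> 'o \<Rightarrow> 'a set" where
  "Hom C X Y = {f \<in> Arr C. Dom C f = X \<and> Cod C f = Y}"

definition category :: "('o, 'a) cat \<Rightarrow> bool" where
  "category C \<longleftrightarrow>
     (\<forall>f\<in>Arr C. Dom C f \<in> Obj C \<and> Cod C f \<in> Obj C) \<and>
     (\<forall>X\<in>Obj C. Idn C X \<in> Hom C X X) \<and>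
     (\<forall>X Y Z f g. f \<in> Hom C X Y \<longrightarrow> g \<in> Hom C Y Z \<longrightarrow> g \<cdot>\<^bsub>C\<^esub> f \<in> Hom C X Z) \<and>
     (\<forall>X Y f. f \<in> Hom C X Y \<longrightarrow> f \<cdot>\<^bsub>C\<^esub> Idn C X = f \<and> Idn C Y \<cdot>\<^bsub>C\<^esub> f = f) \<and>
     (\<forall>W X Y Z f g h. f \<in> Hom C W X \<longrightarrow> g \<in> Hom C X Y \<longrightarrow> h \<in> Hom C Y Z \<longrightarrow>
        (h \<cdot>\<^bsub>C\<^esub> g) \<cdot>\<^bsub>C\<^esub> f = h \<cdot>\<^bsub>C\<^esub> (g \<cdot>\<^bsub>C\<^esub> f))"

definition opp :: "('o, 'a) cat \<Rightarrow> ('o, 'a) cat" where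
  "opp C = \<lparr>Obj = Obj C, Arr = Arr C, Dom = Cod C, Cod = Dom C, Idn = Idn C,
            Cmp = (\<lambda>g f. f \<cdot>\<^bsub>C\<^esub> g)\<rparr>"

definition is_iso :: "('o, 'a) cat \<Rightarrow> 'a \<Rightarrow> bool" where
  "is_iso C f \<longleftrightarrow> f \<in> Arr C \<and>
     (\<exists>g\<in>Hom C (Cod C f) (Dom C f). g \<cdot>\<^bsub>C\<^esub> f = Idn C (Dom C f) \<and> f \<cdot>\<^bsub>C\<^esub> g = Idn C (Cod C f))"

definition terminal_object :: "('o, 'a) cat \<Rightarrow> 'o \<Rightarrow> bool" where
  "terminal_object C T \<longleftrightarrow> T \<in> Obj C \<and> (\<forall>X\<in>Obj C. \<exists>!f. f \<in> Hom C X T)"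

record ('o1, 'a1, 'o2, 'a2) fctr =
  omap :: "'o1 \<Rightarrow> 'o2"
  amap :: "'a1 \<Rightarrow> 'a2"

definition is_functor ::
  "('o1, 'a1) cat \<Rightarrow> ('o2, 'a2) cat \<Rightarrow> ('o1, 'a1, 'o2, 'a2) fctr \<Rightarrow> bool" where
  "is_functor C D F \<longleftrightarrow> category C \<and> category D \<and>
     (\<forall>X\<in>Obj C. omap F X \<in> Obj D) \<and>
     (\<forall>f\<in>Arr C. amap F f \<in> Hom D (omap F (Dom C f)) (omap F (Cod C f))) \<and>
     (\<forall>X\<in>Obj C. amap F (Idn C X) = Idn D (omap F X)) \<and>
     (\<forall>f\<in>Arr C. \<forall>g\<in>Arr C. Cod C f = Dom C g \<longrightarrow>
        amap F (g \<cdot>\<^bsub>C\<^esub> f) = amap F g \<cdot>\<^bsub>D\<^esub> amap F f)"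

definition fid :: "('o, 'a, 'o, 'a) fctr" where
  "fid = \<lparr>omap = (\<lambda>X. X), amap = (\<lambda>f. f)\<rparr>"

definition fcomp ::
  "('o2, 'a2, 'o3, 'a3) fctr \<Rightarrow> ('o1, 'a1, 'o2, 'a2) fctr \<Rightarrow> ('o1, 'a1, 'o3, 'a3) fctr"
  (infixr "\<circ>\<^sub>F" 55) where
  "G \<circ>\<^sub>F F = \<lparr>omap = (\<lambda>X. omap G (omap F X)), amap = (\<lambda>f. amap G (amap F f))\<rparr>"

text \<open>Equality of functors out of \<open>C\<close>: the values outside the carrier sets of \<open>C\<close> are irrelevant.\<close>

definition functor_eq ::
  "('o1, 'a1) cat \<Rightarrow> ('o1, 'a1, 'o2, 'a2) fctr \<Rightarrow> ('o1, 'a1, 'o2, 'a2) fctr \<Rightarrow> bool" where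
  "functor_eq C F G \<longleftrightarrow>
     (\<forall>X\<in>Obj C. omap F X = omap G X) \<and> (\<forall>f\<in>Arr C. amap F f = amap G f)"

definition natural_transformation ::
  "('o1, 'a1) cat \<Rightarrow> ('o2, 'a2) cat \<Rightarrow> ('o1, 'a1, 'o2, 'a2) fctr \<Rightarrow> ('o1, 'a1, 'o2, 'a2) fctr
     \<Rightarrow> ('o1 \<Rightarrow> 'a2) \<Rightarrow> bool" where
  "natural_transformation C D F G \<tau> \<longleftrightarrow>
     (\<forall>X\<in>Obj C. \<tau> X \<in> Hom D (omap F X) (omap G X)) \<and>
     (\<forall>f\<in>Arr C. amap G f \<cdot>\<^bsub>D\<^esub> \<tau> (Dom C f) = \<tau> (Cod C f) \<cdot>\<^bsub>D\<^esub> amap F f)"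

definition natural_isomorphism ::
  "('o1, 'a1) cat \<Rightarrow> ('o2, 'a2) cat \<Rightarrow> ('o1, 'a1, 'o2, 'a2) fctr \<Rightarrow> ('o1, 'a1, 'o2, 'a2) fctr
     \<Rightarrow> ('o1 \<Rightarrow> 'a2) \<Rightarrow> bool" where
  "natural_isomorphism C D F G \<tau> \<longleftrightarrow>
     natural_transformation C D F G \<tau> \<and> (\<forall>X\<in>Obj C. is_iso D (\<tau> X))"

definition left_adjoint ::
  "('o1, 'a1) cat \<Rightarrow> ('o2, 'a2) cat \<Rightarrow> ('o1, 'a1, 'o2, 'a2) fctr \<Rightarrow> ('o2, 'a2, 'o1, 'a1) fctr
     \<Rightarrow> bool" where
  "left_adjoint C D L R \<longleftrightarrow> is_functor C D L \<and> is_functor D C R \<and>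
     (\<exists>\<eta> \<epsilon>. natural_transformation C C fid (R \<circ>\<^sub>F L) \<eta> \<and>
            natural_transformation D D (L \<circ>\<^sub>F R) fid \<epsilon> \<and>
            (\<forall>X\<in>Obj C. \<epsilon> (omap L X) \<cdot>\<^bsub>D\<^esub> amap L (\<eta> X) = Idn D (omap L X)) \<and>
            (\<forall>Y\<in>Obj D. amap R (\<epsilon> Y) \<cdot>\<^bsub>C\<^esub> \<eta> (omap R Y) = Idn C (omap R Y)))"

definition preserves_terminal_objects ::
  "('o1, 'a1) cat \<Rightarrow> ('o2, 'a2) cat \<Rightarrow> ('o1, 'a1, 'o2, 'a2) fctr \<Rightarrow> bool" where
  "preserves_terminal_objects C D F \<longleftrightarrow> is_functor C D F \<and>
     (\<forall>T. terminal_object C T \<longrightarrow> terminal_object D (omap F T))"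

section \<open>Pullbacks and binary products\<close>

definition is_pullback :: "('o, 'a) cat \<Rightarrow> 'a \<Rightarrow> 'a \<Rightarrow> 'a \<Rightarrow> 'a \<Rightarrow> bool" where
  "is_pullback B f g t s \<longleftrightarrow>
     f \<in> Arr B \<and> g \<in> Arr B \<and> Cod B f = Cod B g \<and>
     t \<in> Hom B (Dom B t) (Dom B f) \<and> s \<in> Hom B (Dom B t) (Dom B g) \<and>
     f \<cdot>\<^bsub>B\<^esub> t = g \<cdot>\<^bsub>B\<^esub> s \<and>
     (\<forall>Z\<in>Obj B. \<forall>u\<in>Hom B Z (Dom B f). \<forall>v\<in>Hom B Z (Dom B g).
        f \<cdot>\<^bsub>B\<^esub> u = g \<cdot>\<^bsub>B\<^esub> v \<longrightarrow>
        (\<exists>!h. h \<in> Hom B Z (Dom B t) \<and> t \<cdot>\<^bsub>B\<^esub> h = u \<and> s \<cdot>\<^bsub>B\<^esub> h = v))"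

record ('o, 'a) prod_data =
  prd :: "'o \<Rightarrow> 'o \<Rightarrow> 'o"
  pr1 :: "'o \<Rightarrow> 'o \<Rightarrow> 'a"
  pr2 :: "'o \<Rightarrow> 'o \<Rightarrow> 'a"

definition binary_products :: "('o, 'a) cat \<Rightarrow> ('o, 'a) prod_data \<Rightarrow> bool" where
  "binary_products B p \<longleftrightarrow> (\<forall>X\<in>Obj B. \<forall>Y\<in>Obj B.
     prd p X Y \<in> Obj B \<and> pr1 p X Y \<in> Hom B (prd p X Y) X \<and> pr2 p X Y \<in> Hom B (prd p X Y) Y \<and>
     (\<forall>Z\<in>Obj B. \<forall>u\<in>Hom B Z X. \<forall>v\<in>Hom B Z Y.
        \<exists>!h. h \<in> Hom B Z (prd p X Y) \<and> pr1 p X Y \<cdot>\<^bsub>B\<^esub> h = u \<and> pr2 p X Y \<cdot>\<^bsub>B\<^esub> h = v))"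

definition pairing :: "('o, 'a) cat \<Rightarrow> ('o, 'a) prod_data \<Rightarrow> 'a \<Rightarrow> 'a \<Rightarrow> 'a" where
  "pairing B p u v = (THE h. h \<in> Hom B (Dom B u) (prd p (Cod B u) (Cod B v)) \<and>
     pr1 p (Cod B u) (Cod B v) \<cdot>\<^bsub>B\<^esub> h = u \<and> pr2 p (Cod B u) (Cod B v) \<cdot>\<^bsub>B\<^esub> h = v)"

definition prod_arr :: "('o, 'a) cat \<Rightarrow> ('o, 'a) prod_data \<Rightarrow> 'a \<Rightarrow> 'a \<Rightarrow> 'a" where
  "prod_arr B p f g = pairing B p (f \<cdot>\<^bsub>B\<^esub> pr1 p (Dom B f) (Dom B g)) (g \<cdot>\<^bsub>B\<^esub> pr2 p (Dom B f) (Dom B g))"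

definition diag :: "('o, 'a) cat \<Rightarrow> ('o, 'a) prod_data \<Rightarrow> 'o \<Rightarrow> 'a" where
  "diag B p X = pairing B p (Idn B X) (Idn B X)"

definition square_functor :: "('o, 'a) cat \<Rightarrow> ('o, 'a) prod_data \<Rightarrow> ('o, 'a, 'o, 'a) fctr" where
  "square_functor B p = \<lparr>omap = (\<lambda>X. prd p X X), amap = (\<lambda>f. prod_arr B p f f)\<rparr>"

section \<open>Fibrations, opfibrations and bifibrations\<close>

definition cartesian ::
  "('eo, 'ea) cat \<Rightarrow> ('bo, 'ba) cat \<Rightarrow> ('eo, 'ea, 'bo, 'ba) fctr \<Rightarrow> 'ba \<Rightarrow> 'ea \<Rightarrow> bool" where
  "cartesian E B U f g \<longleftrightarrow> g \<in> Arr E \<and> f \<in> Arr B \<and> amap U g = f \<and>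
     (\<forall>g' v. g' \<in> Arr E \<longrightarrow> Cod E g' = Cod E g \<longrightarrow>
        v \<in> Hom B (omap U (Dom E g')) (Dom B f) \<longrightarrow> amap U g' = f \<cdot>\<^bsub>B\<^esub> v \<longrightarrow>
        (\<exists>!h. h \<in> Hom E (Dom E g') (Dom E g) \<and> amap U h = v \<and> g \<cdot>\<^bsub>E\<^esub> h = g'))"

definition fibration ::
  "('eo, 'ea) cat \<Rightarrow> ('bo, 'ba) cat \<Rightarrow> ('eo, 'ea, 'bo, 'ba) fctr \<Rightarrow> bool" where
  "fibration E B U \<longleftrightarrow> is_functor E B U \<and>
     (\<forall>P\<in>Obj E. \<forall>f\<in>Arr B. Cod B f = omap U P \<longrightarrow>
        (\<exists>g. Cod E g = P \<and> cartesian E B U f g))"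

definition opfibration ::
  "('eo, 'ea) cat \<Rightarrow> ('bo, 'ba) cat \<Rightarrow> ('eo, 'ea, 'bo, 'ba) fctr \<Rightarrow> bool" where
  "opfibration E B U \<longleftrightarrow> fibration (opp E) (opp B) U"

definition bifibration ::
  "('eo, 'ea) cat \<Rightarrow> ('bo, 'ba) cat \<Rightarrow> ('eo, 'ea, 'bo, 'ba) fctr \<Rightarrow> bool" where
  "bifibration E B U \<longleftrightarrow> fibration E B U \<and> opfibration E B U"

text \<open>A cleavage \<open>cl\<close> chooses for \<open>f : X \<rightarrow> UP\<close> a cartesian morphism \<open>cl f P : f\<^sup>*P \<rightarrow> P\<close> above \<open>f\<close>;
  an opcleavage \<open>ocl\<close> chooses for \<open>f : UP \<rightarrow> Y\<close> an opcartesian morphism \<open>ocl f P : P \<rightarrow> \<Sigma>\<^sub>f P\<close>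
  above \<open>f\<close>.\<close>

definition cleavage ::
  "('eo, 'ea) cat \<Rightarrow> ('bo, 'ba) cat \<Rightarrow> ('eo, 'ea, 'bo, 'ba) fctr \<Rightarrow> ('ba \<Rightarrow> 'eo \<Rightarrow> 'ea) \<Rightarrow> bool" where
  "cleavage E B U cl \<longleftrightarrow>
     (\<forall>P\<in>Obj E. \<forall>f\<in>Arr B. Cod B f = omap U P \<longrightarrow>
        Cod E (cl f P) = P \<and> cartesian E B U f (cl f P))"

definition opcleavage ::
  "('eo, 'ea) cat \<Rightarrow> ('bo, 'ba) cat \<Rightarrow> ('eo, 'ea, 'bo, 'ba) fctr \<Rightarrow> ('ba \<Rightarrow> 'eo \<Rightarrow> 'ea) \<Rightarrow> bool" where
  "opcleavage E B U ocl \<longleftrightarrow> cleavage (opp E) (opp B) U ocl"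

definition fibre ::
  "('eo, 'ea) cat \<Rightarrow> ('bo, 'ba) cat \<Rightarrow> ('eo, 'ea, 'bo, 'ba) fctr \<Rightarrow> 'bo \<Rightarrow> ('eo, 'ea) cat" where
  "fibre E B U X = \<lparr>Obj = {P \<in> Obj E. omap U P = X}, Arr = {g \<in> Arr E. amap U g = Idn B X},
     Dom = Dom E, Cod = Cod E, Idn = Idn E, Cmp = Cmp E\<rparr>"

text \<open>On a vertical \<open>v : P \<rightarrow> P'\<close>, \<open>f\<^sup>*v\<close> is the vertical morphism with
  \<open>cl f P' \<cdot> f\<^sup>*v = v \<cdot> cl f P\<close>; dually, \<open>\<Sigma>\<^sub>f v\<close> is the vertical one with
  \<open>\<Sigma>\<^sub>f v \<cdot> ocl f P = ocl f P' \<cdot> v\<close>. The opposite of a functor has the same underlying maps, so the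
  dual construction is again a functor between the fibres of \<open>E\<close> itself.\<close>

definition reindex ::
  "('eo, 'ea) cat \<Rightarrow> ('bo, 'ba) cat \<Rightarrow> ('eo, 'ea, 'bo, 'ba) fctr \<Rightarrow> ('ba \<Rightarrow> 'eo \<Rightarrow> 'ea)
     \<Rightarrow> 'ba \<Rightarrow> ('eo, 'ea, 'eo, 'ea) fctr" where
  "reindex E B U cl f = \<lparr>
     omap = (\<lambda>P. Dom E (cl f P)),
     amap = (\<lambda>v. THE h. h \<in> Hom (fibre E B U (Dom B f)) (Dom E (cl f (Dom E v))) (Dom E (cl f (Cod E v))) \<and>
                        cl f (Cod E v) \<cdot>\<^bsub>E\<^esub> h = v \<cdot>\<^bsub>E\<^esub> cl f (Dom E v))\<rparr>"

definition opreindex ::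
  "('eo, 'ea) cat \<Rightarrow> ('bo, 'ba) cat \<Rightarrow> ('eo, 'ea, 'bo, 'ba) fctr \<Rightarrow> ('ba \<Rightarrow> 'eo \<Rightarrow> 'ea)
     \<Rightarrow> 'ba \<Rightarrow> ('eo, 'ea, 'eo, 'ea) fctr" where
  "opreindex E B U ocl f = reindex (opp E) (opp B) U ocl f"

section \<open>The Beck-Chevalley condition\<close>

text \<open>Unit \<open>P \<rightarrow> f\<^sup>*\<Sigma>\<^sub>f P\<close> and counit \<open>\<Sigma>\<^sub>f f\<^sup>*R \<rightarrow> R\<close> of the adjunction \<open>\<Sigma>\<^sub>f \<stileturn> f\<^sup>*\<close> given by
  the universal properties of the chosen cartesian and opcartesian morphisms.\<close>

definition reindex_unit ::
  "('eo, 'ea) cat \<Rightarrow> ('bo, 'ba) cat \<Rightarrow> ('eo, 'ea, 'bo, 'ba) fctr \<Rightarrow> ('ba \<Rightarrow> 'eo \<Rightarrow> 'ea)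
     \<Rightarrow> ('ba \<Rightarrow> 'eo \<Rightarrow> 'ea) \<Rightarrow> 'ba \<Rightarrow> 'eo \<Rightarrow> 'ea" where
  "reindex_unit E B U cl ocl f P = (THE h.
     h \<in> Hom (fibre E B U (Dom B f)) P (omap (reindex E B U cl f) (omap (opreindex E B U ocl f) P)) \<and>
     cl f (omap (opreindex E B U ocl f) P) \<cdot>\<^bsub>E\<^esub> h = ocl f P)"

definition reindex_counit ::
  "('eo, 'ea) cat \<Rightarrow> ('bo, 'ba) cat \<Rightarrow> ('eo, 'ea, 'bo, 'ba) fctr \<Rightarrow> ('ba \<Rightarrow> 'eo \<Rightarrow> 'ea)
     \<Rightarrow> ('ba \<Rightarrow> 'eo \<Rightarrow> 'ea) \<Rightarrow> 'ba \<Rightarrow> 'eo \<Rightarrow> 'ea" where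
  "reindex_counit E B U cl ocl f R = (THE h.
     h \<in> Hom (fibre E B U (Cod B f)) (omap (opreindex E B U ocl f) (omap (reindex E B U cl f) R)) R \<and>
     h \<cdot>\<^bsub>E\<^esub> ocl f (omap (reindex E B U cl f) R) = cl f R)"

text \<open>For \<open>f t = g s\<close>, the canonical isomorphism \<open>t\<^sup>*f\<^sup>*R \<cong> (ft)\<^sup>*R = (gs)\<^sup>*R \<cong> s\<^sup>*g\<^sup>*R\<close>.\<close>

definition reindex_swap ::
  "('eo, 'ea) cat \<Rightarrow> ('bo, 'ba) cat \<Rightarrow> ('eo, 'ea, 'bo, 'ba) fctr \<Rightarrow> ('ba \<Rightarrow> 'eo \<Rightarrow> 'ea)
     \<Rightarrow> 'ba \<Rightarrow> 'ba \<Rightarrow> 'ba \<Rightarrow> 'ba \<Rightarrow> 'eo \<Rightarrow> 'ea" where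
  "reindex_swap E B U cl f g t s R = (THE h.
     h \<in> Hom (fibre E B U (Dom B t))
           (omap (reindex E B U cl t) (omap (reindex E B U cl f) R))
           (omap (reindex E B U cl s) (omap (reindex E B U cl g) R)) \<and>
     cl g R \<cdot>\<^bsub>E\<^esub> cl s (omap (reindex E B U cl g) R) \<cdot>\<^bsub>E\<^esub> h =
     cl f R \<cdot>\<^bsub>E\<^esub> cl t (omap (reindex E B U cl f) R))"

text \<open>The composite \<open>\<Sigma>\<^sub>s t\<^sup>*P \<rightarrow> \<Sigma>\<^sub>s t\<^sup>*f\<^sup>*\<Sigma>\<^sub>f P \<cong> \<Sigma>\<^sub>s s\<^sup>*g\<^sup>*\<Sigma>\<^sub>f P \<rightarrow> g\<^sup>*\<Sigma>\<^sub>f P\<close>.\<close>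

definition beck_chevalley_map ::
  "('eo, 'ea) cat \<Rightarrow> ('bo, 'ba) cat \<Rightarrow> ('eo, 'ea, 'bo, 'ba) fctr \<Rightarrow> ('ba \<Rightarrow> 'eo \<Rightarrow> 'ea)
     \<Rightarrow> ('ba \<Rightarrow> 'eo \<Rightarrow> 'ea) \<Rightarrow> 'ba \<Rightarrow> 'ba \<Rightarrow> 'ba \<Rightarrow> 'ba \<Rightarrow> 'eo \<Rightarrow> 'ea" where
  "beck_chevalley_map E B U cl ocl f g t s P =
     (let \<Sigma>fP = omap (opreindex E B U ocl f) P in
      reindex_counit E B U cl ocl s (omap (reindex E B U cl g) \<Sigma>fP) \<cdot>\<^bsub>E\<^esub>
      amap (opreindex E B U ocl s) (reindex_swap E B U cl f g t s \<Sigma>fP) \<cdot>\<^bsub>E\<^esub>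
      amap (opreindex E B U ocl s) (amap (reindex E B U cl t) (reindex_unit E B U cl ocl f P)))"

definition beck_chevalley ::
  "('eo, 'ea) cat \<Rightarrow> ('bo, 'ba) cat \<Rightarrow> ('eo, 'ea, 'bo, 'ba) fctr \<Rightarrow> ('ba \<Rightarrow> 'eo \<Rightarrow> 'ea)
     \<Rightarrow> ('ba \<Rightarrow> 'eo \<Rightarrow> 'ea) \<Rightarrow> bool" where
  "beck_chevalley E B U cl ocl \<longleftrightarrow>
     (\<forall>f g t s. is_pullback B f g t s \<longrightarrow>
        natural_isomorphism (fibre E B U (Dom B f)) (fibre E B U (Dom B g))
          (opreindex E B U ocl s \<circ>\<^sub>F reindex E B U cl t)
          (reindex E B U cl g \<circ>\<^sub>F opreindex E B U ocl f)
          (beck_chevalley_map E B U cl ocl f g t s))"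

section \<open>Truth, relations and equality\<close>

definition truth_functor ::
  "('eo, 'ea) cat \<Rightarrow> ('bo, 'ba) cat \<Rightarrow> ('eo, 'ea, 'bo, 'ba) fctr \<Rightarrow> ('ba \<Rightarrow> 'eo \<Rightarrow> 'ea)
     \<Rightarrow> ('bo, 'ba, 'eo, 'ea) fctr \<Rightarrow> bool" where
  "truth_functor E B U cl K \<longleftrightarrow> is_functor B E K \<and> functor_eq B (U \<circ>\<^sub>F K) fid \<and>
     (\<forall>X\<in>Obj B. terminal_object (fibre E B U X) (omap K X)) \<and>
     (\<forall>f\<in>Arr B. \<forall>T. terminal_object (fibre E B U (Cod B f)) T \<longrightarrow>
        terminal_object (fibre E B U (Dom B f)) (omap (reindex E B U cl f) T))"

definition base_change_cat ::
  "('ao, 'aa) cat \<Rightarrow> ('eo, 'ea) cat \<Rightarrow> ('ao, 'aa, 'bo, 'ba) fctr \<Rightarrow> ('eo, 'ea, 'bo, 'ba) fctr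
     \<Rightarrow> ('ao \<times> 'eo, 'aa \<times> 'ea) cat" where
  "base_change_cat A E G U = \<lparr>
     Obj = {(X, P). X \<in> Obj A \<and> P \<in> Obj E \<and> omap U P = omap G X},
     Arr = {(f, g). f \<in> Arr A \<and> g \<in> Arr E \<and> amap U g = amap G f},
     Dom = (\<lambda>(f, g). (Dom A f, Dom E g)),
     Cod = (\<lambda>(f, g). (Cod A f, Cod E g)),
     Idn = (\<lambda>(X, P). (Idn A X, Idn E P)),
     Cmp = (\<lambda>(f', g') (f, g). (f' \<cdot>\<^bsub>A\<^esub> f, g' \<cdot>\<^bsub>E\<^esub> g))\<rparr>"

definition base_change_functor :: "('ao \<times> 'eo, 'aa \<times> 'ea, 'ao, 'aa) fctr" where
  "base_change_functor = \<lparr>omap = fst, amap = fst\<rparr>"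

definition Rel_cat ::
  "('eo, 'ea) cat \<Rightarrow> ('bo, 'ba) cat \<Rightarrow> ('eo, 'ea, 'bo, 'ba) fctr \<Rightarrow> ('bo, 'ba) prod_data
     \<Rightarrow> ('bo \<times> 'eo, 'ba \<times> 'ea) cat" where
  "Rel_cat E B U p = base_change_cat B E (square_functor B p) U"

abbreviation Rel_fibration :: "('bo \<times> 'eo, 'ba \<times> 'ea, 'bo, 'ba) fctr" where
  "Rel_fibration \<equiv> base_change_functor"

text \<open>\<open>Eq X = (X, \<Sigma>\<^sub>\<delta> K X)\<close>. The \<open>E\<close>-component of \<open>Eq f\<close> is obtained from
  \<open>\<delta>\<^sub>Y f = (f \<times> f) \<delta>\<^sub>X\<close> and the opcartesian morphism \<open>K X \<rightarrow> \<Sigma>\<^sub>\<delta> K X\<close> above \<open>\<delta>\<^sub>X\<close>.\<close>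

definition eq_functor ::
  "('eo, 'ea) cat \<Rightarrow> ('bo, 'ba) cat \<Rightarrow> ('eo, 'ea, 'bo, 'ba) fctr \<Rightarrow> ('bo, 'ba) prod_data
     \<Rightarrow> ('ba \<Rightarrow> 'eo \<Rightarrow> 'ea) \<Rightarrow> ('bo, 'ba, 'eo, 'ea) fctr
     \<Rightarrow> ('bo, 'ba, 'bo \<times> 'eo, 'ba \<times> 'ea) fctr" where
  "eq_functor E B U p ocl K =
     (let \<Sigma>\<delta>K = (\<lambda>X. omap (opreindex E B U ocl (diag B p X)) (omap K X));
          \<sigma> = (\<lambda>X. ocl (diag B p X) (omap K X))
      in \<lparr>omap = (\<lambda>X. (X, \<Sigma>\<delta>K X)),
          amap = (\<lambda>f. (f, THE h. h \<in> Hom E (\<Sigma>\<delta>K (Dom B f)) (\<Sigma>\<delta>K (Cod B f)) \<and>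
                               amap U h = prod_arr B p f f \<and>
                               h \<cdot>\<^bsub>E\<^esub> \<sigma> (Dom B f) = \<sigma> (Cod B f) \<cdot>\<^bsub>E\<^esub> amap K f))\<rparr>)"

section \<open>Coalgebras, liftings and coinduction\<close>

text \<open>A coalgebra morphism is recorded together with its domain and codomain.\<close>

definition Coalg ::
  "('o, 'a) cat \<Rightarrow> ('o, 'a, 'o, 'a) fctr
     \<Rightarrow> ('o \<times> 'a, ('o \<times> 'a) \<times> 'a \<times> ('o \<times> 'a)) cat" where
  "Coalg C F = (let Co = {(X, \<alpha>). X \<in> Obj C \<and> \<alpha> \<in> Hom C X (omap F X)} in \<lparr>
     Obj = Co,
     Arr = {(a, f, b). a \<in> Co \<and> b \<in> Co \<and> f \<in> Hom C (fst a) (fst b) \<and>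
                       amap F f \<cdot>\<^bsub>C\<^esub> snd a = snd b \<cdot>\<^bsub>C\<^esub> f},
     Dom = (\<lambda>(a, f, b). a),
     Cod = (\<lambda>(a, f, b). b),
     Idn = (\<lambda>a. (a, Idn C (fst a), a)),
     Cmp = (\<lambda>(b', g, c) (a, f, b). (a, g \<cdot>\<^bsub>C\<^esub> f, c))\<rparr>)"

definition is_lifting ::
  "('ro, 'ra) cat \<Rightarrow> ('ro, 'ra, 'bo, 'ba) fctr \<Rightarrow> ('bo, 'ba, 'bo, 'ba) fctr
     \<Rightarrow> ('ro, 'ra, 'ro, 'ra) fctr \<Rightarrow> bool" where
  "is_lifting R V F F' \<longleftrightarrow> is_functor R R F' \<and> functor_eq R (V \<circ>\<^sub>F F') (F \<circ>\<^sub>F V)"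

definition eq_preserving ::
  "('bo, 'ba) cat \<Rightarrow> ('ro, 'ra) cat \<Rightarrow> ('bo, 'ba, 'ro, 'ra) fctr \<Rightarrow> ('bo, 'ba, 'bo, 'ba) fctr
     \<Rightarrow> ('ro, 'ra, 'ro, 'ra) fctr \<Rightarrow> ('bo \<Rightarrow> 'ra) \<Rightarrow> bool" where
  "eq_preserving B R Eq F F' \<phi> \<longleftrightarrow> natural_isomorphism B R (Eq \<circ>\<^sub>F F) (F' \<circ>\<^sub>F Eq) \<phi>"

definition coalg_eq ::
  "('ro, 'ra) cat \<Rightarrow> ('bo, 'ba, 'ro, 'ra) fctr \<Rightarrow> ('bo \<Rightarrow> 'ra)
     \<Rightarrow> ('bo \<times> 'ba, ('bo \<times> 'ba) \<times> 'ba \<times> ('bo \<times> 'ba),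
         'ro \<times> 'ra, ('ro \<times> 'ra) \<times> 'ra \<times> ('ro \<times> 'ra)) fctr" where
  "coalg_eq R Eq \<phi> =
     (let G = (\<lambda>(X, \<alpha>). (omap Eq X, \<phi> X \<cdot>\<^bsub>R\<^esub> amap Eq \<alpha>))
      in \<lparr>omap = G, amap = (\<lambda>(a, f, b). (G a, amap Eq f, G b))\<rparr>)"

definition sound_coinduction_rule ::
  "('bo, 'ba) cat \<Rightarrow> ('ro, 'ra) cat \<Rightarrow> ('bo, 'ba, 'ro, 'ra) fctr \<Rightarrow> ('bo, 'ba, 'bo, 'ba) fctr
     \<Rightarrow> ('ro, 'ra, 'ro, 'ra) fctr \<Rightarrow> ('bo \<Rightarrow> 'ra) \<Rightarrow> bool" where
  "sound_coinduction_rule B R Eq F F' \<phi> \<longleftrightarrow>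
     preserves_terminal_objects (Coalg B F) (Coalg R F') (coalg_eq R Eq \<phi>)"

end

theory Submission
  imports Defs
begin

text \<open>
  Let \<open>\<eta>\<close> be the unit of \<open>Q \<stileturn> Eq\<close> and \<open>\<rho>\<^sub>P : UP \<rightarrow> QP\<close> the image of \<open>\<eta>\<^sub>P\<close> in the base.
  The lifting is \<open>P \<mapsto> (F \<rho>\<^sub>P)\<^sup>* (Eq F Q P)\<close>, with cartesian morphism \<open>c\<^sub>P\<close> into \<open>Eq F Q P\<close>.
  It preserves equality because \<open>Eq\<close> is full and faithful, which makes the counit \<open>\<epsilon>\<close> invertible:
  a morphism \<open>Eq X \<rightarrow> Eq Y\<close> above \<open>f\<close> amounts to a vertical morphism \<open>KX \<rightarrow> f\<^sup>*\<delta>\<^sup>*\<Sigma>\<^sub>\<delta> KY\<close>, and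
  \<open>\<delta>\<^sup>*\<Sigma>\<^sub>\<delta> KY\<close> is terminal by the Beck-Chevalley condition for the kernel pair of the monomorphism
  \<open>\<delta>\<close>. For a coalgebra \<open>q\<close> of the lifting on \<open>P\<close>, the transpose of \<open>c\<^sub>P q\<close> is an \<open>F\<close>-coalgebra
  on \<open>QP\<close>, and transposition identifies coalgebra morphisms from \<open>q\<close> to \<open>Eq \<nu>F\<close> with
  coalgebra morphisms from this one to \<open>\<nu>F\<close>.
\<close>

section \<open>Categories and functors\<close>

lemma Hom_iff: "f \<in> Hom C X Y \<longleftrightarrow> f \<in> Arr C \<and> Dom C f = X \<and> Cod C f = Y"
  by (auto simp: Hom_def)

lemma Arr_Hom: "f \<in> Arr C \<Longrightarrow> f \<in> Hom C (Dom C f) (Cod C f)"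
  by (simp add: Hom_iff)

lemma cat_Obj:
  assumes "category C" "f \<in> Hom C X Y"
  shows "X \<in> Obj C" "Y \<in> Obj C"
  using assms by (auto simp: category_def Hom_iff)

lemma cat_Idn: "category C \<Longrightarrow> X \<in> Obj C \<Longrightarrow> Idn C X \<in> Hom C X X"
  by (simp add: category_def)

lemma cat_comp:
  "category C \<Longrightarrow> f \<in> Hom C X Y \<Longrightarrow> g \<in> Hom C Y Z \<Longrightarrow> g \<cdot>\<^bsub>C\<^esub> f \<in> Hom C X Z"
  unfolding category_def by blast

lemma cat_idr: "category C \<Longrightarrow> f \<in> Hom C X Y \<Longrightarrow> f \<cdot>\<^bsub>C\<^esub> Idn C X = f"
  unfolding category_def by blast

lemma cat_idl: "category C \<Longrightarrow> f \<in> Hom C X Y \<Longrightarrow> Idn C Y \<cdot>\<^bsub>C\<^esub> f = f"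
  unfolding category_def by blast

lemma cat_assoc:
  "category C \<Longrightarrow> f \<in> Hom C W X \<Longrightarrow> g \<in> Hom C X Y \<Longrightarrow> h \<in> Hom C Y Z \<Longrightarrow>
    (h \<cdot>\<^bsub>C\<^esub> g) \<cdot>\<^bsub>C\<^esub> f = h \<cdot>\<^bsub>C\<^esub> (g \<cdot>\<^bsub>C\<^esub> f)"
  unfolding category_def by blast

lemma categoryI:
  assumes "\<And>X Y f. f \<in> Hom C X Y \<Longrightarrow> X \<in> Obj C \<and> Y \<in> Obj C"
    and "\<And>X. X \<in> Obj C \<Longrightarrow> Idn C X \<in> Hom C X X"
    and "\<And>X Y Z f g. f \<in> Hom C X Y \<Longrightarrow> g \<in> Hom C Y Z \<Longrightarrow> g \<cdot>\<^bsub>C\<^esub> f \<in> Hom C X Z"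
    and "\<And>X Y f. f \<in> Hom C X Y \<Longrightarrow> f \<cdot>\<^bsub>C\<^esub> Idn C X = f"
    and "\<And>X Y f. f \<in> Hom C X Y \<Longrightarrow> Idn C Y \<cdot>\<^bsub>C\<^esub> f = f"
    and "\<And>W X Y Z f g h. f \<in> Hom C W X \<Longrightarrow> g \<in> Hom C X Y \<Longrightarrow> h \<in> Hom C Y Z \<Longrightarrow>
        (h \<cdot>\<^bsub>C\<^esub> g) \<cdot>\<^bsub>C\<^esub> f = h \<cdot>\<^bsub>C\<^esub> (g \<cdot>\<^bsub>C\<^esub> f)"
  shows "category C"
  unfolding category_def
  by (intro conjI ballI allI impI) (simp add: assms(1)[OF Arr_Hom] | (rule assms(2-); assumption))+

lemma functor_cat:
  assumes "is_functor C D F"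
  shows "category C" "category D"
  using assms by (simp_all add: is_functor_def)

lemma functor_Obj: "is_functor C D F \<Longrightarrow> X \<in> Obj C \<Longrightarrow> omap F X \<in> Obj D"
  by (simp add: is_functor_def)

lemma functor_Hom:
  "is_functor C D F \<Longrightarrow> f \<in> Hom C X Y \<Longrightarrow> amap F f \<in> Hom D (omap F X) (omap F Y)"
  by (auto simp: is_functor_def Hom_iff)

lemma functor_Idn: "is_functor C D F \<Longrightarrow> X \<in> Obj C \<Longrightarrow> amap F (Idn C X) = Idn D (omap F X)"
  by (simp add: is_functor_def)

lemma functor_comp:
  "is_functor C D F \<Longrightarrow> f \<in> Hom C X Y \<Longrightarrow> g \<in> Hom C Y Z \<Longrightarrow>
    amap F (g \<cdot>\<^bsub>C\<^esub> f) = amap F g \<cdot>\<^bsub>D\<^esub> amap F f"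
  by (auto simp: is_functor_def Hom_iff)

lemma functorI:
  assumes "category C" "category D"
    and "\<And>X. X \<in> Obj C \<Longrightarrow> omap F X \<in> Obj D"
    and "\<And>X Y f. f \<in> Hom C X Y \<Longrightarrow> amap F f \<in> Hom D (omap F X) (omap F Y)"
    and "\<And>X. X \<in> Obj C \<Longrightarrow> amap F (Idn C X) = Idn D (omap F X)"
    and "\<And>X Y Z f g. f \<in> Hom C X Y \<Longrightarrow> g \<in> Hom C Y Z \<Longrightarrow>
        amap F (g \<cdot>\<^bsub>C\<^esub> f) = amap F g \<cdot>\<^bsub>D\<^esub> amap F f"
  shows "is_functor C D F"
  unfolding is_functor_def
proof (intro conjI ballI impI)
  fix f g assume "f \<in> Arr C" "g \<in> Arr C" "Cod C f = Dom C g"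
  then show "amap F (g \<cdot>\<^bsub>C\<^esub> f) = amap F g \<cdot>\<^bsub>D\<^esub> amap F f"
    using assms(6)[OF Arr_Hom, of f g "Cod C g"] Arr_Hom[of g C] by simp
qed (simp_all add: assms(1-3,5) assms(4)[OF Arr_Hom])

lemma nat_Hom:
  "natural_transformation C D F G \<tau> \<Longrightarrow> X \<in> Obj C \<Longrightarrow> \<tau> X \<in> Hom D (omap F X) (omap G X)"
  by (simp add: natural_transformation_def)

lemma nat_square:
  "natural_transformation C D F G \<tau> \<Longrightarrow> f \<in> Hom C X Y \<Longrightarrow>
    amap G f \<cdot>\<^bsub>D\<^esub> \<tau> X = \<tau> Y \<cdot>\<^bsub>D\<^esub> amap F f"
  by (auto simp: natural_transformation_def Hom_iff)

lemma fcomp_simps [simp]: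
  "omap (G \<circ>\<^sub>F F) X = omap G (omap F X)" "amap (G \<circ>\<^sub>F F) f = amap G (amap F f)"
  by (simp_all add: fcomp_def)

lemma fid_simps [simp]: "omap fid X = X" "amap fid f = f"
  by (simp_all add: fid_def)

text \<open>Composing the unique arrow into \<open>T\<close> with \<open>i\<close> gives an arrow
  into \<open>Cod C i\<close>; any other arrow there becomes an arrow into \<open>T\<close> after
  composition with the inverse \<open>j\<close>, hence agrees with it. Terminality is carried this
  way along the Beck-Chevalley isomorphism.\<close>

lemma terminal_object_iso:
  assumes "category C" "terminal_object C T" "is_iso C i" "Dom C i = T"
  shows "terminal_object C (Cod C i)"
proof -
  let ?S = "Cod C i"
  have i: "i \<in> Hom C T ?S" using assms by (simp add: is_iso_def Hom_iff)
  obtain j where j: "j \<in> Hom C ?S T" "i \<cdot>\<^bsub>C\<^esub> j = Idn C ?S"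
    using assms by (auto simp: is_iso_def)
  have "\<exists>!f. f \<in> Hom C X ?S" if X: "X \<in> Obj C" for X
  proof -
    obtain t where t: "t \<in> Hom C X T" and t': "\<And>u. u \<in> Hom C X T \<Longrightarrow> u = t"
      using assms(2) X unfolding terminal_object_def by blast
    show ?thesis
    proof (rule ex1I)
      show "i \<cdot>\<^bsub>C\<^esub> t \<in> Hom C X ?S" by (rule cat_comp[OF assms(1) t i])
    next
      fix f assume f: "f \<in> Hom C X ?S"
      have "j \<cdot>\<^bsub>C\<^esub> f = t" by (rule t'[OF cat_comp[OF assms(1) f j(1)]])
      then have "i \<cdot>\<^bsub>C\<^esub> t = (i \<cdot>\<^bsub>C\<^esub> j) \<cdot>\<^bsub>C\<^esub> f"
        using cat_assoc[OF assms(1) f j(1) i] by simp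
      then show "f = i \<cdot>\<^bsub>C\<^esub> t" using j(2) cat_idl[OF assms(1) f] by simp
    qed
  qed
  then show ?thesis using cat_Obj[OF assms(1) i] by (simp add: terminal_object_def)
qed

section \<open>Coalgebras\<close>

lemma Coalg_Obj:
  "(X, \<alpha>) \<in> Obj (Coalg C F) \<longleftrightarrow> X \<in> Obj C \<and> \<alpha> \<in> Hom C X (omap F X)"
  by (simp add: Coalg_def Let_def)

lemma Coalg_Hom:
  "m \<in> Hom (Coalg C F) a b \<longleftrightarrow> (\<exists>f. m = (a, f, b) \<and> a \<in> Obj (Coalg C F) \<and> b \<in> Obj (Coalg C F) \<and>
     f \<in> Hom C (fst a) (fst b) \<and> amap F f \<cdot>\<^bsub>C\<^esub> snd a = snd b \<cdot>\<^bsub>C\<^esub> f)"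
  by (auto simp: Coalg_def Let_def Hom_iff)

lemma Coalg_Idn: "Idn (Coalg C F) a = (a, Idn C (fst a), a)"
  by (simp add: Coalg_def Let_def)

lemma Coalg_Cmp: "(b', g, c) \<cdot>\<^bsub>Coalg C F\<^esub> (a, f, b) = (a, g \<cdot>\<^bsub>C\<^esub> f, c)"
  by (simp add: Coalg_def Let_def)

text \<open>The main point is that the squares of two coalgebra morphisms paste, by functoriality of
  \<open>F\<close> and associativity in \<open>C\<close>.\<close>

lemma category_Coalg:
  assumes F: "is_functor C C F"
  shows "category (Coalg C F)"
proof (rule categoryI)
  note C = functor_cat(1)[OF F]
  fix a b c d m n l
  assume m: "m \<in> Hom (Coalg C F) a b" and n: "n \<in> Hom (Coalg C F) b c"
  obtain X \<alpha> Y \<beta> Z \<gamma> where a: "a = (X, \<alpha>)" and b: "b = (Y, \<beta>)" and c: "c = (Z, \<gamma>)"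
    by (cases a, cases b, cases c)
  from m obtain f where f: "m = (a, f, b)" "f \<in> Hom C X Y" "amap F f \<cdot>\<^bsub>C\<^esub> \<alpha> = \<beta> \<cdot>\<^bsub>C\<^esub> f"
    and \<alpha>: "\<alpha> \<in> Hom C X (omap F X)" and \<beta>: "\<beta> \<in> Hom C Y (omap F Y)" and ob: "a \<in> Obj (Coalg C F)"
    by (auto simp: Coalg_Hom a b Coalg_Obj)
  from n obtain g where g: "n = (b, g, c)" "g \<in> Hom C Y Z" "amap F g \<cdot>\<^bsub>C\<^esub> \<beta> = \<gamma> \<cdot>\<^bsub>C\<^esub> g"
    and \<gamma>: "\<gamma> \<in> Hom C Z (omap F Z)" and oc: "c \<in> Obj (Coalg C F)"
    by (auto simp: Coalg_Hom b c Coalg_Obj)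
  have "amap F (g \<cdot>\<^bsub>C\<^esub> f) \<cdot>\<^bsub>C\<^esub> \<alpha> = amap F g \<cdot>\<^bsub>C\<^esub> (amap F f \<cdot>\<^bsub>C\<^esub> \<alpha>)"
    using functor_comp[OF F f(2) g(2)]
      cat_assoc[OF C \<alpha> functor_Hom[OF F f(2)] functor_Hom[OF F g(2)]] by simp
  also have "\<dots> = (amap F g \<cdot>\<^bsub>C\<^esub> \<beta>) \<cdot>\<^bsub>C\<^esub> f"
    using f(3) cat_assoc[OF C f(2) \<beta> functor_Hom[OF F g(2)]] by simp
  also have "\<dots> = \<gamma> \<cdot>\<^bsub>C\<^esub> (g \<cdot>\<^bsub>C\<^esub> f)"
    using g(3) cat_assoc[OF C f(2) g(2) \<gamma>] by simp
  finally show "n \<cdot>\<^bsub>Coalg C F\<^esub> m \<in> Hom (Coalg C F) a c"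
    using f(1) g(1) ob oc cat_comp[OF C f(2) g(2)] by (simp add: Coalg_Hom Coalg_Cmp a b c)
  assume "l \<in> Hom (Coalg C F) c d"
  then obtain h where h: "l = (c, h, d)" "h \<in> Hom C Z (fst d)"
    by (auto simp: Coalg_Hom c)
  show "(l \<cdot>\<^bsub>Coalg C F\<^esub> n) \<cdot>\<^bsub>Coalg C F\<^esub> m = l \<cdot>\<^bsub>Coalg C F\<^esub> (n \<cdot>\<^bsub>Coalg C F\<^esub> m)"
    using f(1) g(1) h cat_assoc[OF C f(2) g(2) h(2)] by (simp add: Coalg_Cmp)
next
  note C = functor_cat(1)[OF F]
  fix a assume a: "a \<in> Obj (Coalg C F)"
  obtain X \<alpha> where a': "a = (X, \<alpha>)" by (cases a)
  have X: "X \<in> Obj C" and \<alpha>: "\<alpha> \<in> Hom C X (omap F X)" using a by (auto simp: a' Coalg_Obj)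
  show "Idn (Coalg C F) a \<in> Hom (Coalg C F) a a"
    using a functor_Idn[OF F X] cat_Idn[OF C X] cat_idl[OF C \<alpha>] cat_idr[OF C \<alpha>]
    by (simp add: Coalg_Hom Coalg_Idn a')
next
  note C = functor_cat(1)[OF F]
  fix a b m assume "m \<in> Hom (Coalg C F) a b"
  then show "a \<in> Obj (Coalg C F) \<and> b \<in> Obj (Coalg C F)"
    and "m \<cdot>\<^bsub>Coalg C F\<^esub> Idn (Coalg C F) a = m" and "Idn (Coalg C F) b \<cdot>\<^bsub>Coalg C F\<^esub> m = m"
    by (auto simp: Coalg_Hom Coalg_Idn Coalg_Cmp cat_idl[OF C] cat_idr[OF C])
qed

lemma coalg_eq_simps:
  "omap (coalg_eq R Eq \<phi>) (X, \<alpha>) = (omap Eq X, \<phi> X \<cdot>\<^bsub>R\<^esub> amap Eq \<alpha>)"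
  "amap (coalg_eq R Eq \<phi>) (a, f, b) =
     (omap (coalg_eq R Eq \<phi>) a, amap Eq f, omap (coalg_eq R Eq \<phi>) b)"
  by (simp_all add: coalg_eq_def Let_def)

text \<open>The \<open>Eq\<close>-image of a coalgebra square pastes with a naturality square of
  \<open>\<phi>\<close> to the square that makes \<open>Eq f\<close> a coalgebra morphism. This
  supplies the functoriality contained in \<open>preserves_terminal_objects\<close>.\<close>

lemma functor_coalg_eq:
  assumes F: "is_functor B B F" and F': "is_functor R R F'" and Eq: "is_functor B R Eq"
    and \<phi>: "natural_transformation B R (Eq \<circ>\<^sub>F F) (F' \<circ>\<^sub>F Eq) \<phi>"
  shows "is_functor (Coalg B F) (Coalg R F') (coalg_eq R Eq \<phi>)"
proof -
  let ?G = "coalg_eq R Eq \<phi>"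
  note B = functor_cat(1)[OF F] and R = functor_cat(1)[OF F']
  have \<phi>H: "\<phi> X \<in> Hom R (omap Eq (omap F X)) (omap F' (omap Eq X))" if "X \<in> Obj B" for X
    using nat_Hom[OF \<phi> that] by simp
  have obj: "omap ?G a \<in> Obj (Coalg R F')" if "a \<in> Obj (Coalg B F)" for a
  proof -
    obtain X \<alpha> where a: "a = (X, \<alpha>)" by (cases a)
    have "X \<in> Obj B" "\<alpha> \<in> Hom B X (omap F X)" using that by (auto simp: a Coalg_Obj)
    then show ?thesis
      using cat_comp[OF R functor_Hom[OF Eq] \<phi>H] functor_Obj[OF Eq]
      by (simp add: a coalg_eq_simps Coalg_Obj)
  qed
  show ?thesis
  proof (rule functorI)
    show "category (Coalg B F)" "category (Coalg R F')"
      using category_Coalg F F' by blast+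
  next
    fix a b m assume m: "m \<in> Hom (Coalg B F) a b"
    obtain X \<alpha> Y \<beta> where a: "a = (X, \<alpha>)" and b: "b = (Y, \<beta>)" by (cases a, cases b)
    from m obtain f where f: "m = (a, f, b)" "f \<in> Hom B X Y" "amap F f \<cdot>\<^bsub>B\<^esub> \<alpha> = \<beta> \<cdot>\<^bsub>B\<^esub> f"
      and \<alpha>: "\<alpha> \<in> Hom B X (omap F X)" and \<beta>: "\<beta> \<in> Hom B Y (omap F Y)"
      and X: "X \<in> Obj B" and Y: "Y \<in> Obj B"
      and oa: "a \<in> Obj (Coalg B F)" and ob: "b \<in> Obj (Coalg B F)"
      by (auto simp: Coalg_Hom a b Coalg_Obj)
    note Ef = functor_Hom[OF Eq f(2)]
    note EFf = functor_Hom[OF Eq functor_Hom[OF F f(2)]]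
    note E\<alpha> = functor_Hom[OF Eq \<alpha>] and E\<beta> = functor_Hom[OF Eq \<beta>]
    have "amap F' (amap Eq f) \<cdot>\<^bsub>R\<^esub> (\<phi> X \<cdot>\<^bsub>R\<^esub> amap Eq \<alpha>)
        = (amap F' (amap Eq f) \<cdot>\<^bsub>R\<^esub> \<phi> X) \<cdot>\<^bsub>R\<^esub> amap Eq \<alpha>"
      using cat_assoc[OF R E\<alpha> \<phi>H[OF X] functor_Hom[OF F' Ef]] by simp
    also have "\<dots> = \<phi> Y \<cdot>\<^bsub>R\<^esub> (amap Eq (amap F f) \<cdot>\<^bsub>R\<^esub> amap Eq \<alpha>)"
      using nat_square[OF \<phi> f(2)] cat_assoc[OF R E\<alpha> EFf \<phi>H[OF Y]] by simp
    also have "\<dots> = \<phi> Y \<cdot>\<^bsub>R\<^esub> (amap Eq \<beta> \<cdot>\<^bsub>R\<^esub> amap Eq f)"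
      using functor_comp[OF Eq \<alpha> functor_Hom[OF F f(2)]] functor_comp[OF Eq f(2) \<beta>] f(3) by simp
    also have "\<dots> = (\<phi> Y \<cdot>\<^bsub>R\<^esub> amap Eq \<beta>) \<cdot>\<^bsub>R\<^esub> amap Eq f"
      using cat_assoc[OF R Ef E\<beta> \<phi>H[OF Y]] by simp
    finally show "amap ?G m \<in> Hom (Coalg R F') (omap ?G a) (omap ?G b)"
      using obj[OF oa] obj[OF ob] Ef by (simp add: f(1) a b coalg_eq_simps Coalg_Hom)
  next
    fix a assume a: "a \<in> Obj (Coalg B F)"
    then show "amap ?G (Idn (Coalg B F) a) = Idn (Coalg R F') (omap ?G a)"
      using functor_Idn[OF Eq] by (cases a) (simp add: Coalg_Idn coalg_eq_simps Coalg_Obj)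
  next
    fix a b c m n assume "m \<in> Hom (Coalg B F) a b" "n \<in> Hom (Coalg B F) b c"
    then show "amap ?G (n \<cdot>\<^bsub>Coalg B F\<^esub> m) = amap ?G n \<cdot>\<^bsub>Coalg R F'\<^esub> amap ?G m"
      by (auto simp: Coalg_Hom Coalg_Cmp coalg_eq_simps functor_comp[OF Eq])
  qed (use obj in auto)
qed

section \<open>Fibrations with a full equality functor that has a left adjoint\<close>

text \<open>The definition of \<open>cartesian\<close> measures base arrows against
  \<open>Dom B f\<close>. Since \<open>g\<close> lies above \<open>f\<close>, this object is
  \<open>omap U P\<close>, so the universal property can be phrased by hom-sets alone.\<close>

lemma cartesian_ex1:
  assumes "is_functor E B U" "cartesian E B U f g" "g \<in> Hom E P P'" "g' \<in> Hom E S P'"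
    and "v \<in> Hom B (omap U S) (omap U P)" "amap U g' = f \<cdot>\<^bsub>B\<^esub> v"
  shows "\<exists>!h. h \<in> Hom E S P \<and> amap U h = v \<and> g \<cdot>\<^bsub>E\<^esub> h = g'"
proof -
  have "Dom B f = omap U P"
    using functor_Hom[OF assms(1,3)] assms(2) by (simp add: cartesian_def Hom_iff)
  moreover have "g' \<in> Arr E" "Cod E g' = Cod E g" "Dom E g' = S" "Dom E g = P"
    using assms(3,4) by (auto simp: Hom_iff)
  ultimately show ?thesis
    using assms(2)[unfolded cartesian_def, THEN conjunct2, THEN conjunct2, THEN conjunct2,
        rule_format, of g' v] assms(5,6) by simp
qed

text \<open>\<open>h\<close> and \<open>h'\<close> both factor the same arrow through the cartesian
  \<open>g\<close>, over the same base arrow.\<close>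

lemma cartesian_unique:
  assumes U: "is_functor E B U" and c: "cartesian E B U f g" and g: "g \<in> Hom E P P'"
    and h: "h \<in> Hom E S P" and h': "h' \<in> Hom E S P"
    and eq: "amap U h = amap U h'" "g \<cdot>\<^bsub>E\<^esub> h = g \<cdot>\<^bsub>E\<^esub> h'"
  shows "h = h'"
proof -
  have "amap U (g \<cdot>\<^bsub>E\<^esub> h) = f \<cdot>\<^bsub>B\<^esub> amap U h"
    using functor_comp[OF U h g] c by (simp add: cartesian_def)
  from cartesian_ex1[OF U c g cat_comp[OF functor_cat(1)[OF U] h g] functor_Hom[OF U h] this]
  show ?thesis using h h' eq by metis
qed

text \<open>An abstract form of the relational setting: \<open>R\<close> and \<open>V\<close> stand
  for the category of relations and its fibration. Products, truth and Beck-Chevalley enter only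
  through \<open>full\<close>; faithfulness of \<open>Eq\<close> is implicit in
  \<open>retraction\<close>. The adjunction is given by unit, counit and triangle
  identities.\<close>

locale full_equality =
  fixes R :: "('ro, 'ra) cat" and B :: "('bo, 'ba) cat" and V :: "('ro, 'ra, 'bo, 'ba) fctr"
    and Eq :: "('bo, 'ba, 'ro, 'ra) fctr" and Q :: "('ro, 'ra, 'bo, 'ba) fctr"
    and \<eta> :: "'ro \<Rightarrow> 'ra" and \<epsilon> :: "'bo \<Rightarrow> 'ba" and F :: "('bo, 'ba, 'bo, 'ba) fctr"
  assumes fib: "fibration R B V"
    and Eq: "is_functor B R Eq"
    and retraction: "functor_eq B (V \<circ>\<^sub>F Eq) fid"
    and full: "X \<in> Obj B \<Longrightarrow> Y \<in> Obj B \<Longrightarrow> u \<in> Hom R (omap Eq X) (omap Eq Y) \<Longrightarrow>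
      u = amap Eq (amap V u)"
    and Q: "is_functor R B Q"
    and \<eta>: "natural_transformation R R fid (Eq \<circ>\<^sub>F Q) \<eta>"
    and \<epsilon>: "natural_transformation B B (Q \<circ>\<^sub>F Eq) fid \<epsilon>"
    and triQ: "P \<in> Obj R \<Longrightarrow> \<epsilon> (omap Q P) \<cdot>\<^bsub>B\<^esub> amap Q (\<eta> P) = Idn B (omap Q P)"
    and triEq: "X \<in> Obj B \<Longrightarrow> amap Eq (\<epsilon> X) \<cdot>\<^bsub>R\<^esub> \<eta> (omap Eq X) = Idn R (omap Eq X)"
    and F: "is_functor B B F"
begin

lemma V: "is_functor R B V"
  using fib by (simp add: fibration_def)

lemmas R = functor_cat(1)[OF V] and B = functor_cat(2)[OF V]

lemma VEq [simp]: "X \<in> Obj B \<Longrightarrow> omap V (omap Eq X) = X"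
  using retraction by (simp add: functor_eq_def)

lemma VEq_arr: "f \<in> Hom B X Y \<Longrightarrow> amap V (amap Eq f) = f"
  using retraction by (simp add: functor_eq_def Hom_iff)

section \<open>Transposition along the adjunction between \<open>Q\<close> and
  \<open>Eq\<close>\<close>

lemma \<eta>_Hom: "P \<in> Obj R \<Longrightarrow> \<eta> P \<in> Hom R P (omap Eq (omap Q P))"
  using nat_Hom[OF \<eta>] by simp

lemma \<epsilon>_Hom: "X \<in> Obj B \<Longrightarrow> \<epsilon> X \<in> Hom B (omap Q (omap Eq X)) X"
  using nat_Hom[OF \<epsilon>] by simp

lemma \<eta>_square: "h \<in> Hom R P P' \<Longrightarrow> amap Eq (amap Q h) \<cdot>\<^bsub>R\<^esub> \<eta> P = \<eta> P' \<cdot>\<^bsub>R\<^esub> h"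
  using nat_square[OF \<eta>] by simp

lemma \<epsilon>_square: "f \<in> Hom B X Y \<Longrightarrow> f \<cdot>\<^bsub>B\<^esub> \<epsilon> X = \<epsilon> Y \<cdot>\<^bsub>B\<^esub> amap Q (amap Eq f)"
  using nat_square[OF \<epsilon>] by simp

text \<open>Naturality of \<open>\<eta>\<close> at \<open>f\<close> brings
  \<open>\<eta> (Eq X)\<close> next to \<open>Eq (\<epsilon> X)\<close>, where a triangle identity
  cancels them. Together with the next lemma this gives the bijection between arrows
  \<open>P \<rightarrow> Eq X\<close> and arrows \<open>Q P \<rightarrow> X\<close>.\<close>

lemma transpose_inverse:
  assumes f: "f \<in> Hom R P (omap Eq X)" and X: "X \<in> Obj B"
  shows "amap Eq (\<epsilon> X \<cdot>\<^bsub>B\<^esub> amap Q f) \<cdot>\<^bsub>R\<^esub> \<eta> P = f"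
proof -
  note P = cat_Obj(1)[OF R f]
  note Qf = functor_Hom[OF Q f]
  have "amap Eq (\<epsilon> X \<cdot>\<^bsub>B\<^esub> amap Q f) \<cdot>\<^bsub>R\<^esub> \<eta> P = amap Eq (\<epsilon> X) \<cdot>\<^bsub>R\<^esub> (\<eta> (omap Eq X) \<cdot>\<^bsub>R\<^esub> f)"
    using functor_comp[OF Eq Qf \<epsilon>_Hom[OF X]] \<eta>_square[OF f]
      cat_assoc[OF R \<eta>_Hom[OF P] functor_Hom[OF Eq Qf] functor_Hom[OF Eq \<epsilon>_Hom[OF X]]]
    by simp
  also have "\<dots> = f"
    using cat_assoc[OF R f \<eta>_Hom[OF functor_Obj[OF Eq X]] functor_Hom[OF Eq \<epsilon>_Hom[OF X]]]
      triEq[OF X] cat_idl[OF R f] by simp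
  finally show ?thesis .
qed

text \<open>Naturality of \<open>\<epsilon>\<close> at \<open>g\<close> brings
  \<open>\<epsilon> (Q P)\<close> next to \<open>Q (\<eta> P)\<close>, and the other triangle
  identity applies.\<close>

lemma transpose_transpose:
  assumes g: "g \<in> Hom B (omap Q P) X" and P: "P \<in> Obj R"
  shows "\<epsilon> X \<cdot>\<^bsub>B\<^esub> amap Q (amap Eq g \<cdot>\<^bsub>R\<^esub> \<eta> P) = g"
proof -
  note X = cat_Obj(2)[OF B g]
  note QP = functor_Obj[OF Q P]
  note QEg = functor_Hom[OF Q functor_Hom[OF Eq g]]
  note Q\<eta> = functor_Hom[OF Q \<eta>_Hom[OF P]]
  have "\<epsilon> X \<cdot>\<^bsub>B\<^esub> amap Q (amap Eq g \<cdot>\<^bsub>R\<^esub> \<eta> P) = (g \<cdot>\<^bsub>B\<^esub> \<epsilon> (omap Q P)) \<cdot>\<^bsub>B\<^esub> amap Q (\<eta> P)"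
    using functor_comp[OF Q \<eta>_Hom[OF P] functor_Hom[OF Eq g]] \<epsilon>_square[OF g]
      cat_assoc[OF B Q\<eta> QEg \<epsilon>_Hom[OF X]] by simp
  also have "\<dots> = g"
    using cat_assoc[OF B Q\<eta> \<epsilon>_Hom[OF QP] g] triQ[OF P] cat_idr[OF B g] by simp
  finally show ?thesis .
qed

lemma transpose_inject:
  assumes "g \<in> Hom B (omap Q P) X" "g' \<in> Hom B (omap Q P) X" "P \<in> Obj R"
    and "amap Eq g \<cdot>\<^bsub>R\<^esub> \<eta> P = amap Eq g' \<cdot>\<^bsub>R\<^esub> \<eta> P"
  shows "g = g'"
  using transpose_transpose assms by metis

section \<open>The comparison of \<open>V\<close> with \<open>Q\<close>\<close>

definition \<rho> :: "'ro \<Rightarrow> 'ba" where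
  "\<rho> P = amap V (\<eta> P)"

lemma \<rho>_Hom: "P \<in> Obj R \<Longrightarrow> \<rho> P \<in> Hom B (omap V P) (omap Q P)"
  using functor_Hom[OF V \<eta>_Hom] functor_Obj[OF Q] by (simp add: \<rho>_def)

text \<open>\<open>V\<close> is applied to the naturality square of \<open>\<eta>\<close>; since
  \<open>V\<close> undoes \<open>Eq\<close>, the arrow \<open>Eq (Q h)\<close> becomes
  \<open>Q h\<close>. Thus \<open>\<rho>\<close> is natural from \<open>V\<close> to
  \<open>Q\<close>.\<close>

lemma \<rho>_square:
  assumes h: "h \<in> Hom R P P'"
  shows "amap Q h \<cdot>\<^bsub>B\<^esub> \<rho> P = \<rho> P' \<cdot>\<^bsub>B\<^esub> amap V h"
proof -
  note P = cat_Obj[OF R h]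
  note Qh = functor_Hom[OF Q h]
  show ?thesis
    using functor_comp[OF V \<eta>_Hom[OF P(1)] functor_Hom[OF Eq Qh]] \<eta>_square[OF h]
      functor_comp[OF V h \<eta>_Hom[OF P(2)]] VEq_arr[OF Qh]
    by (simp add: \<rho>_def)
qed

text \<open>The image under \<open>V\<close> of the triangle identity \<open>triEq\<close>.\<close>

lemma \<epsilon>_\<rho>:
  assumes X: "X \<in> Obj B"
  shows "\<epsilon> X \<cdot>\<^bsub>B\<^esub> \<rho> (omap Eq X) = Idn B X"
  using functor_comp[OF V \<eta>_Hom[OF functor_Obj[OF Eq X]] functor_Hom[OF Eq \<epsilon>_Hom[OF X]]]
    triEq[OF X] functor_Idn[OF V functor_Obj[OF Eq X]] VEq_arr[OF \<epsilon>_Hom[OF X]] X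
  by (simp add: \<rho>_def)

text \<open>By fullness \<open>\<eta> (Eq X) = Eq (\<rho> (Eq X))\<close>, so naturality of \<open>\<epsilon>\<close> at \<open>\<rho> (Eq X)\<close> reduces
  this to a triangle identity.\<close>

lemma \<rho>_\<epsilon>:
  assumes X: "X \<in> Obj B"
  shows "\<rho> (omap Eq X) \<cdot>\<^bsub>B\<^esub> \<epsilon> X = Idn B (omap Q (omap Eq X))"
proof -
  note EX = functor_Obj[OF Eq X]
  have r: "\<rho> (omap Eq X) \<in> Hom B X (omap Q (omap Eq X))" using \<rho>_Hom[OF EX] X by simp
  have "amap Eq (\<rho> (omap Eq X)) = \<eta> (omap Eq X)"
    using full[OF X functor_Obj[OF Q EX] \<eta>_Hom[OF EX]] by (simp add: \<rho>_def)
  then show ?thesis using \<epsilon>_square[OF r] triQ[OF EX] by simp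
qed

section \<open>The lifting of \<open>F\<close>, by reindexing along \<open>F \<rho>\<close>\<close>

definition lift_map :: "'ro \<Rightarrow> 'ra" where
  "lift_map P = (SOME g. Cod R g = omap Eq (omap F (omap Q P)) \<and>
     cartesian R B V (amap F (\<rho> P)) g)"

text \<open>The cartesian arrows \<open>lift_map P\<close> are picked by choice because the locale
  fixes no cleavage for \<open>V\<close>. On arrows, prescribing \<open>amap V k\<close> puts the
  lifting strictly above \<open>F\<close>, and the last equation makes \<open>lift_map\<close>
  natural.\<close>

definition lift :: "('ro, 'ra, 'ro, 'ra) fctr" where
  "lift = \<lparr>omap = (\<lambda>P. Dom R (lift_map P)),
     amap = (\<lambda>h. THE k. k \<in> Hom R (Dom R (lift_map (Dom R h))) (Dom R (lift_map (Cod R h))) \<and>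
       amap V k = amap F (amap V h) \<and>
       lift_map (Cod R h) \<cdot>\<^bsub>R\<^esub> k = amap Eq (amap F (amap Q h)) \<cdot>\<^bsub>R\<^esub> lift_map (Dom R h))\<rparr>"

lemma lift_map:
  assumes P: "P \<in> Obj R"
  shows lift_map_Hom: "lift_map P \<in> Hom R (omap lift P) (omap Eq (omap F (omap Q P)))"
    and lift_map_cartesian: "cartesian R B V (amap F (\<rho> P)) (lift_map P)"
    and V_lift_map: "amap V (lift_map P) = amap F (\<rho> P)"
    and V_lift: "omap V (omap lift P) = omap F (omap V P)"
proof -
  note Fr = functor_Hom[OF F \<rho>_Hom[OF P]]
  have FQ: "omap F (omap Q P) \<in> Obj B" by (intro functor_Obj[OF F] functor_Obj[OF Q] P)
  have "Cod B (amap F (\<rho> P)) = omap V (omap Eq (omap F (omap Q P)))" "amap F (\<rho> P) \<in> Arr B"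
    using Fr FQ by (simp_all add: Hom_iff)
  then have "\<exists>g. Cod R g = omap Eq (omap F (omap Q P)) \<and> cartesian R B V (amap F (\<rho> P)) g"
    using fib functor_Obj[OF Eq FQ] unfolding fibration_def by blast
  then have *: "Cod R (lift_map P) = omap Eq (omap F (omap Q P)) \<and>
      cartesian R B V (amap F (\<rho> P)) (lift_map P)"
    unfolding lift_map_def by (rule someI_ex)
  then show c: "cartesian R B V (amap F (\<rho> P)) (lift_map P)" by simp
  show h: "lift_map P \<in> Hom R (omap lift P) (omap Eq (omap F (omap Q P)))"
    using * by (simp add: Hom_iff lift_def cartesian_def)
  show v: "amap V (lift_map P) = amap F (\<rho> P)" using c by (simp add: cartesian_def)
  show "omap V (omap lift P) = omap F (omap V P)"
    using functor_Hom[OF V h] Fr v by (simp add: Hom_iff)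
qed

lemma lift_Obj: "P \<in> Obj R \<Longrightarrow> omap lift P \<in> Obj R"
  using cat_Obj(1)[OF R lift_map_Hom] .

text \<open>By \<open>\<rho>_square\<close> the composite on the right lies above
  \<open>F (\<rho> P') \<cdot> F (V h)\<close>, so it factors uniquely through the cartesian
  \<open>lift_map P'\<close>.\<close>

lemma lift_ex1:
  assumes h: "h \<in> Hom R P P'"
  shows "\<exists>!k. k \<in> Hom R (omap lift P) (omap lift P') \<and> amap V k = amap F (amap V h) \<and>
    lift_map P' \<cdot>\<^bsub>R\<^esub> k = amap Eq (amap F (amap Q h)) \<cdot>\<^bsub>R\<^esub> lift_map P"
proof (rule cartesian_ex1[OF V])
  note P = cat_Obj[OF R h]
  note Qh = functor_Hom[OF Q h]
  note FQh = functor_Hom[OF F Qh]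
  show "cartesian R B V (amap F (\<rho> P')) (lift_map P')" by (rule lift_map_cartesian[OF P(2)])
  show "lift_map P' \<in> Hom R (omap lift P') (omap Eq (omap F (omap Q P')))"
    by (rule lift_map_Hom[OF P(2)])
  show "amap Eq (amap F (amap Q h)) \<cdot>\<^bsub>R\<^esub> lift_map P
      \<in> Hom R (omap lift P) (omap Eq (omap F (omap Q P')))"
    by (rule cat_comp[OF R lift_map_Hom[OF P(1)] functor_Hom[OF Eq FQh]])
  show "amap F (amap V h) \<in> Hom B (omap V (omap lift P)) (omap V (omap lift P'))"
    using functor_Hom[OF F functor_Hom[OF V h]] V_lift P by simp
  show "amap V (amap Eq (amap F (amap Q h)) \<cdot>\<^bsub>R\<^esub> lift_map P) =
      amap F (\<rho> P') \<cdot>\<^bsub>B\<^esub> amap F (amap V h)"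
    using functor_comp[OF V lift_map_Hom[OF P(1)] functor_Hom[OF Eq FQh]] V_lift_map[OF P(1)]
      VEq_arr[OF FQh] functor_comp[OF F \<rho>_Hom[OF P(1)] Qh] \<rho>_square[OF h]
      functor_comp[OF F functor_Hom[OF V h] \<rho>_Hom[OF P(2)]] by simp
qed

lemma lift_arr:
  assumes h: "h \<in> Hom R P P'"
  shows lift_Hom: "amap lift h \<in> Hom R (omap lift P) (omap lift P')"
    and V_lift_arr: "amap V (amap lift h) = amap F (amap V h)"
    and lift_map_square:
      "lift_map P' \<cdot>\<^bsub>R\<^esub> amap lift h = amap Eq (amap F (amap Q h)) \<cdot>\<^bsub>R\<^esub> lift_map P"
proof -
  have "amap lift h = (THE k. k \<in> Hom R (omap lift P) (omap lift P') \<and>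
      amap V k = amap F (amap V h) \<and>
      lift_map P' \<cdot>\<^bsub>R\<^esub> k = amap Eq (amap F (amap Q h)) \<cdot>\<^bsub>R\<^esub> lift_map P)"
    using h by (simp add: lift_def Hom_iff)
  with theI'[OF lift_ex1[OF h]]
  show "amap lift h \<in> Hom R (omap lift P) (omap lift P')"
    "amap V (amap lift h) = amap F (amap V h)"
    "lift_map P' \<cdot>\<^bsub>R\<^esub> amap lift h = amap Eq (amap F (amap Q h)) \<cdot>\<^bsub>R\<^esub> lift_map P"
    by simp_all
qed

lemma lift_eqI:
  assumes "h \<in> Hom R P P'" "k \<in> Hom R (omap lift P) (omap lift P')"
    and "amap V k = amap F (amap V h)"
    and "lift_map P' \<cdot>\<^bsub>R\<^esub> k = amap Eq (amap F (amap Q h)) \<cdot>\<^bsub>R\<^esub> lift_map P"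
  shows "amap lift h = k"
  using lift_ex1[OF assms(1)] lift_arr[OF assms(1)] assms(2-) by blast

text \<open>By uniqueness of the factorisation it suffices that identities and composites satisfy
  the two equations characterising \<open>amap lift\<close>; for composites the
  \<open>lift_map\<close> squares paste.\<close>

lemma functor_lift: "is_functor R R lift"
proof (rule functorI[OF R R])
  fix P assume P: "P \<in> Obj R"
  show "amap lift (Idn R P) = Idn R (omap lift P)"
  proof (rule lift_eqI[OF cat_Idn[OF R P]])
    show "Idn R (omap lift P) \<in> Hom R (omap lift P) (omap lift P)"
      using cat_Idn[OF R lift_Obj[OF P]] .
    show "amap V (Idn R (omap lift P)) = amap F (amap V (Idn R P))"
      using functor_Idn[OF V P] functor_Idn[OF F functor_Obj[OF V P]]
        functor_Idn[OF V lift_Obj[OF P]] V_lift[OF P] by simp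
    have "amap Eq (amap F (amap Q (Idn R P))) = Idn R (omap Eq (omap F (omap Q P)))"
      using functor_Idn[OF Q P] functor_Idn[OF F functor_Obj[OF Q P]]
        functor_Idn[OF Eq functor_Obj[OF F functor_Obj[OF Q P]]] by simp
    then show "lift_map P \<cdot>\<^bsub>R\<^esub> Idn R (omap lift P) =
        amap Eq (amap F (amap Q (Idn R P))) \<cdot>\<^bsub>R\<^esub> lift_map P"
      using cat_idl[OF R lift_map_Hom[OF P]] cat_idr[OF R lift_map_Hom[OF P]] by simp
  qed
next
  fix P P' P'' h h' assume h: "h \<in> Hom R P P'" and h': "h' \<in> Hom R P' P''"
  note P = cat_Obj[OF R h] and P'' = cat_Obj(2)[OF R h']
  note Lh = lift_Hom[OF h] and Lh' = lift_Hom[OF h']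
  note Qh = functor_Hom[OF Q h] and Qh' = functor_Hom[OF Q h']
  note FQh = functor_Hom[OF F Qh] and FQh' = functor_Hom[OF F Qh']
  show "amap lift (h' \<cdot>\<^bsub>R\<^esub> h) = amap lift h' \<cdot>\<^bsub>R\<^esub> amap lift h"
  proof (rule lift_eqI[OF cat_comp[OF R h h'] cat_comp[OF R Lh Lh']])
    show "amap V (amap lift h' \<cdot>\<^bsub>R\<^esub> amap lift h) = amap F (amap V (h' \<cdot>\<^bsub>R\<^esub> h))"
      using functor_comp[OF V Lh Lh'] functor_comp[OF V h h']
        functor_comp[OF F functor_Hom[OF V h] functor_Hom[OF V h']]
        V_lift_arr[OF h] V_lift_arr[OF h'] by simp
    have "lift_map P'' \<cdot>\<^bsub>R\<^esub> (amap lift h' \<cdot>\<^bsub>R\<^esub> amap lift h)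
        = (amap Eq (amap F (amap Q h')) \<cdot>\<^bsub>R\<^esub> lift_map P') \<cdot>\<^bsub>R\<^esub> amap lift h"
      using cat_assoc[OF R Lh Lh' lift_map_Hom[OF P'']] lift_map_square[OF h'] by simp
    also have "\<dots> = amap Eq (amap F (amap Q h')) \<cdot>\<^bsub>R\<^esub>
        (amap Eq (amap F (amap Q h)) \<cdot>\<^bsub>R\<^esub> lift_map P)"
      using cat_assoc[OF R Lh lift_map_Hom[OF P(2)] functor_Hom[OF Eq FQh']]
        lift_map_square[OF h] by simp
    also have "\<dots> = amap Eq (amap F (amap Q (h' \<cdot>\<^bsub>R\<^esub> h))) \<cdot>\<^bsub>R\<^esub> lift_map P"
      using cat_assoc[OF R lift_map_Hom[OF P(1)] functor_Hom[OF Eq FQh] functor_Hom[OF Eq FQh']]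
        functor_comp[OF Eq FQh FQh'] functor_comp[OF F Qh Qh'] functor_comp[OF Q h h'] by simp
    finally show "lift_map P'' \<cdot>\<^bsub>R\<^esub> (amap lift h' \<cdot>\<^bsub>R\<^esub> amap lift h) =
        amap Eq (amap F (amap Q (h' \<cdot>\<^bsub>R\<^esub> h))) \<cdot>\<^bsub>R\<^esub> lift_map P" .
  qed
qed (use lift_Obj lift_Hom in auto)

lemma is_lifting_lift: "is_lifting R V F lift"
  using functor_lift V_lift V_lift_arr[OF Arr_Hom]
  by (simp add: is_lifting_def functor_eq_def)

text \<open>The inverse of the isomorphism needed for preservation of equality. This direction has a
  direct formula, so it is treated first and \<open>\<phi>\<close> is then taken to be its
  inverse.\<close>

definition \<psi> :: "'bo \<Rightarrow> 'ra" where
  "\<psi> X = amap Eq (amap F (\<epsilon> X)) \<cdot>\<^bsub>R\<^esub> lift_map (omap Eq X)"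

lemma EqF\<epsilon>_Hom:
  "X \<in> Obj B \<Longrightarrow>
    amap Eq (amap F (\<epsilon> X)) \<in> Hom R (omap Eq (omap F (omap Q (omap Eq X)))) (omap Eq (omap F X))"
  by (intro functor_Hom[OF Eq] functor_Hom[OF F] \<epsilon>_Hom)

lemma \<psi>_Hom: "X \<in> Obj B \<Longrightarrow> \<psi> X \<in> Hom R (omap lift (omap Eq X)) (omap Eq (omap F X))"
  unfolding \<psi>_def by (intro cat_comp[OF R lift_map_Hom EqF\<epsilon>_Hom] functor_Obj[OF Eq])

text \<open>The \<open>lift_map\<close> square moves \<open>lift f\<close> past the cartesian arrow,
  and functoriality merges what remains into the transpose of \<open>f\<close>. Both the naturality
  of \<open>\<psi>\<close> and the comparison of coalgebra morphisms rest on this.\<close>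

lemma \<psi>_lift:
  assumes f: "f \<in> Hom R P (omap Eq X)" and X: "X \<in> Obj B"
  shows "\<psi> X \<cdot>\<^bsub>R\<^esub> amap lift f = amap Eq (amap F (\<epsilon> X \<cdot>\<^bsub>B\<^esub> amap Q f)) \<cdot>\<^bsub>R\<^esub> lift_map P"
proof -
  note P = cat_Obj[OF R f]
  note Qf = functor_Hom[OF Q f]
  note FQf = functor_Hom[OF F Qf]
  note Fe = functor_Hom[OF F \<epsilon>_Hom[OF X]]
  show ?thesis
    using cat_assoc[OF R lift_Hom[OF f] lift_map_Hom[OF P(2)] EqF\<epsilon>_Hom[OF X]]
      lift_map_square[OF f] functor_comp[OF F Qf \<epsilon>_Hom[OF X]] functor_comp[OF Eq FQf Fe]
      cat_assoc[OF R lift_map_Hom[OF P(1)] functor_Hom[OF Eq FQf] EqF\<epsilon>_Hom[OF X]]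
    by (simp add: \<psi>_def)
qed

text \<open>This is \<open>\<psi>_lift\<close> at \<open>Eq f\<close>, whose transpose is
  \<open>f \<cdot> \<epsilon> X\<close> by naturality of \<open>\<epsilon>\<close>.\<close>

lemma \<psi>_square:
  assumes f: "f \<in> Hom B X Y"
  shows "\<psi> Y \<cdot>\<^bsub>R\<^esub> amap lift (amap Eq f) = amap Eq (amap F f) \<cdot>\<^bsub>R\<^esub> \<psi> X"
proof -
  note X = cat_Obj[OF B f]
  note Ff = functor_Hom[OF F f]
  show ?thesis
    using \<psi>_lift[OF functor_Hom[OF Eq f] X(2)] \<epsilon>_square[OF f]
      functor_comp[OF F \<epsilon>_Hom[OF X(1)] f]
      functor_comp[OF Eq functor_Hom[OF F \<epsilon>_Hom[OF X(1)]] Ff]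
      cat_assoc[OF R lift_map_Hom[OF functor_Obj[OF Eq X(1)]] EqF\<epsilon>_Hom[OF X(1)]
        functor_Hom[OF Eq Ff]]
    by (simp add: \<psi>_def)
qed

text \<open>\<open>\<epsilon> X\<close> is invertible, and a cartesian morphism above an isomorphism is an isomorphism.\<close>

lemma \<psi>_inverse:
  assumes X: "X \<in> Obj B"
  shows "\<exists>\<phi>. \<phi> \<in> Hom R (omap Eq (omap F X)) (omap lift (omap Eq X)) \<and>
    \<psi> X \<cdot>\<^bsub>R\<^esub> \<phi> = Idn R (omap Eq (omap F X)) \<and> \<phi> \<cdot>\<^bsub>R\<^esub> \<psi> X = Idn R (omap lift (omap Eq X))"
proof -
  note EX = functor_Obj[OF Eq X]
  let ?c = "lift_map (omap Eq X)" and ?r = "\<rho> (omap Eq X)" and ?e = "\<epsilon> X"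
  have r: "?r \<in> Hom B X (omap Q (omap Eq X))" using \<rho>_Hom[OF EX] X by simp
  note e = \<epsilon>_Hom[OF X]
  note Fr = functor_Hom[OF F r] and Fe = functor_Hom[OF F e]
  note EFr = functor_Hom[OF Eq Fr] and EFe = functor_Hom[OF Eq Fe]
  note c = lift_map_Hom[OF EX]
  note FX = functor_Obj[OF F X]
  note LX = lift_Obj[OF EX]
  have VL: "omap V (omap lift (omap Eq X)) = omap F X" using V_lift[OF EX] X by simp
  have id: "Idn B (omap F X) \<in> Hom B (omap V (omap Eq (omap F X))) (omap V (omap lift (omap Eq X)))"
    using cat_Idn[OF B FX] FX VL by simp
  have "amap V (amap Eq (amap F ?r)) = amap F ?r \<cdot>\<^bsub>B\<^esub> Idn B (omap F X)"
    using VEq_arr[OF Fr] cat_idr[OF B Fr] by simp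
  \<comment> \<open>The candidate inverse: \<open>Eq (F \<rho>)\<close> lies above
    \<open>F \<rho>\<close> and therefore factors through the cartesian arrow \<open>?c\<close> by
    an arrow above an identity.\<close>
  from cartesian_ex1[OF V lift_map_cartesian[OF EX] c EFr id this]
  obtain \<phi> where \<phi>: "\<phi> \<in> Hom R (omap Eq (omap F X)) (omap lift (omap Eq X))"
    and V\<phi>: "amap V \<phi> = Idn B (omap F X)" and c\<phi>: "?c \<cdot>\<^bsub>R\<^esub> \<phi> = amap Eq (amap F ?r)"
    by blast
  have "\<psi> X \<cdot>\<^bsub>R\<^esub> \<phi> = amap Eq (amap F ?e) \<cdot>\<^bsub>R\<^esub> amap Eq (amap F ?r)"
    using cat_assoc[OF R \<phi> c EFe] c\<phi> by (simp add: \<psi>_def)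
  also have "\<dots> = Idn R (omap Eq (omap F X))"
    using functor_comp[OF Eq Fr Fe] functor_comp[OF F r e] \<epsilon>_\<rho>[OF X]
      functor_Idn[OF F X] functor_Idn[OF Eq FX] by simp
  finally have 1: "\<psi> X \<cdot>\<^bsub>R\<^esub> \<phi> = Idn R (omap Eq (omap F X))" .
  note p = \<psi>_Hom[OF X]
  \<comment> \<open>Arrows into the domain of \<open>?c\<close> are compared by their images under
    \<open>V\<close> and their composites with \<open>?c\<close>. The first comparison uses
    \<open>\<epsilon>_\<rho>\<close>, the second \<open>\<rho>_\<epsilon>\<close>.\<close>
  have 2: "\<phi> \<cdot>\<^bsub>R\<^esub> \<psi> X = Idn R (omap lift (omap Eq X))"
  proof (rule cartesian_unique[OF V lift_map_cartesian[OF EX] c cat_comp[OF R p \<phi>] cat_Idn[OF R LX]])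
    have "amap V (\<psi> X) = amap F ?e \<cdot>\<^bsub>B\<^esub> amap F ?r"
      using functor_comp[OF V c EFe] VEq_arr[OF Fe] V_lift_map[OF EX] by (simp add: \<psi>_def)
    also have "\<dots> = Idn B (omap F X)"
      using functor_comp[OF F r e] \<epsilon>_\<rho>[OF X] functor_Idn[OF F X] by simp
    finally show "amap V (\<phi> \<cdot>\<^bsub>R\<^esub> \<psi> X) = amap V (Idn R (omap lift (omap Eq X)))"
      using functor_comp[OF V p \<phi>] V\<phi> functor_Idn[OF V LX] VL
        cat_idl[OF B cat_Idn[OF B FX]] by simp
    have "?c \<cdot>\<^bsub>R\<^esub> (\<phi> \<cdot>\<^bsub>R\<^esub> \<psi> X) = amap Eq (amap F ?r) \<cdot>\<^bsub>R\<^esub> \<psi> X"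
      using cat_assoc[OF R p \<phi> c] c\<phi> by simp
    also have "\<dots> = amap Eq (amap F (?r \<cdot>\<^bsub>B\<^esub> ?e)) \<cdot>\<^bsub>R\<^esub> ?c"
      using cat_assoc[OF R c EFe EFr] functor_comp[OF Eq Fe Fr] functor_comp[OF F e r]
      by (simp add: \<psi>_def)
    also have "\<dots> = ?c"
      using \<rho>_\<epsilon>[OF X] functor_Idn[OF F functor_Obj[OF Q EX]]
        functor_Idn[OF Eq functor_Obj[OF F functor_Obj[OF Q EX]]] cat_idl[OF R c] by simp
    finally show "?c \<cdot>\<^bsub>R\<^esub> (\<phi> \<cdot>\<^bsub>R\<^esub> \<psi> X) = ?c \<cdot>\<^bsub>R\<^esub> Idn R (omap lift (omap Eq X))"
      using cat_idr[OF R c] by simp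
  qed
  show ?thesis using \<phi> 1 2 by blast
qed

definition \<phi> :: "'bo \<Rightarrow> 'ra" where
  "\<phi> X = (SOME k. k \<in> Hom R (omap Eq (omap F X)) (omap lift (omap Eq X)) \<and>
    \<psi> X \<cdot>\<^bsub>R\<^esub> k = Idn R (omap Eq (omap F X)) \<and> k \<cdot>\<^bsub>R\<^esub> \<psi> X = Idn R (omap lift (omap Eq X)))"

lemma \<phi>:
  assumes X: "X \<in> Obj B"
  shows \<phi>_Hom: "\<phi> X \<in> Hom R (omap Eq (omap F X)) (omap lift (omap Eq X))"
    and \<psi>_\<phi>: "\<psi> X \<cdot>\<^bsub>R\<^esub> \<phi> X = Idn R (omap Eq (omap F X))"
    and \<phi>_\<psi>: "\<phi> X \<cdot>\<^bsub>R\<^esub> \<psi> X = Idn R (omap lift (omap Eq X))"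
  using someI_ex[OF \<psi>_inverse[OF X], folded \<phi>_def] by blast+

text \<open>Naturality passes from \<open>\<psi>\<close> to its inverse: insert
  \<open>\<psi> X \<cdot> \<phi> X\<close>, apply \<open>\<psi>_square\<close>, cancel
  \<open>\<phi> Y \<cdot> \<psi> Y\<close>.\<close>

lemma eq_preserving_lift: "eq_preserving B R Eq F lift \<phi>"
  unfolding eq_preserving_def natural_isomorphism_def natural_transformation_def
proof (intro conjI ballI)
  fix X assume X: "X \<in> Obj B"
  show "\<phi> X \<in> Hom R (omap (Eq \<circ>\<^sub>F F) X) (omap (lift \<circ>\<^sub>F Eq) X)" using \<phi>_Hom[OF X] by simp
  have "\<phi> X \<in> Arr R" "Dom R (\<phi> X) = omap Eq (omap F X)" "Cod R (\<phi> X) = omap lift (omap Eq X)"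
    using \<phi>_Hom[OF X] by (simp_all add: Hom_iff)
  then show "is_iso R (\<phi> X)"
    unfolding is_iso_def using \<psi>_\<phi>[OF X] \<phi>_\<psi>[OF X] \<psi>_Hom[OF X]
    by (intro conjI bexI[of _ "\<psi> X"]) simp_all
next
  fix f assume "f \<in> Arr B"
  then obtain X Y where f: "f \<in> Hom B X Y" by (rule that[OF Arr_Hom])
  note X = cat_Obj[OF B f]
  note EFf = functor_Hom[OF Eq functor_Hom[OF F f]]
  note Lf = lift_Hom[OF functor_Hom[OF Eq f]]
  note Lfp = cat_comp[OF R \<phi>_Hom[OF X(1)] Lf]
  have "\<phi> Y \<cdot>\<^bsub>R\<^esub> amap Eq (amap F f) = \<phi> Y \<cdot>\<^bsub>R\<^esub> (amap Eq (amap F f) \<cdot>\<^bsub>R\<^esub> (\<psi> X \<cdot>\<^bsub>R\<^esub> \<phi> X))"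
    using \<psi>_\<phi>[OF X(1)] cat_idr[OF R EFf] by simp
  also have "\<dots> = \<phi> Y \<cdot>\<^bsub>R\<^esub> ((\<psi> Y \<cdot>\<^bsub>R\<^esub> amap lift (amap Eq f)) \<cdot>\<^bsub>R\<^esub> \<phi> X)"
    using cat_assoc[OF R \<phi>_Hom[OF X(1)] \<psi>_Hom[OF X(1)] EFf] \<psi>_square[OF f] by simp
  also have "\<dots> = (\<phi> Y \<cdot>\<^bsub>R\<^esub> \<psi> Y) \<cdot>\<^bsub>R\<^esub> (amap lift (amap Eq f) \<cdot>\<^bsub>R\<^esub> \<phi> X)"
    using cat_assoc[OF R \<phi>_Hom[OF X(1)] Lf \<psi>_Hom[OF X(2)]]
      cat_assoc[OF R Lfp \<psi>_Hom[OF X(2)] \<phi>_Hom[OF X(2)]] by simp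
  also have "\<dots> = amap lift (amap Eq f) \<cdot>\<^bsub>R\<^esub> \<phi> X"
    using \<phi>_\<psi>[OF X(2)] cat_idl[OF R Lfp] by simp
  finally show "amap (lift \<circ>\<^sub>F Eq) f \<cdot>\<^bsub>R\<^esub> \<phi> (Dom B f) = \<phi> (Cod B f) \<cdot>\<^bsub>R\<^esub> amap (Eq \<circ>\<^sub>F F) f"
    using f by (simp add: Hom_iff)
qed

text \<open>The hypothesis on \<open>a\<close> makes it the transpose of
  \<open>lift_map P \<cdot> q\<close>. Since \<open>\<psi> Z\<close> is invertible, the first
  equation may be composed with it; by \<open>\<psi>_lift\<close> and
  \<open>transpose_inverse\<close> both sides then are an \<open>Eq\<close>-image after
  \<open>\<eta> P\<close>, and transposition is injective.\<close>

lemma lift_coalgebra_transpose: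
  assumes P: "P \<in> Obj R" and q: "q \<in> Hom R P (omap lift P)"
    and Z: "Z \<in> Obj B" and \<zeta>: "\<zeta> \<in> Hom B Z (omap F Z)"
    and a: "a \<in> Hom B (omap Q P) (omap F (omap Q P))" "amap Eq a \<cdot>\<^bsub>R\<^esub> \<eta> P = lift_map P \<cdot>\<^bsub>R\<^esub> q"
    and f: "f \<in> Hom R P (omap Eq Z)"
  shows "amap lift f \<cdot>\<^bsub>R\<^esub> q = (\<phi> Z \<cdot>\<^bsub>R\<^esub> amap Eq \<zeta>) \<cdot>\<^bsub>R\<^esub> f \<longleftrightarrow>
    amap F (\<epsilon> Z \<cdot>\<^bsub>B\<^esub> amap Q f) \<cdot>\<^bsub>B\<^esub> a = \<zeta> \<cdot>\<^bsub>B\<^esub> (\<epsilon> Z \<cdot>\<^bsub>B\<^esub> amap Q f)"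
proof -
  let ?g = "\<epsilon> Z \<cdot>\<^bsub>B\<^esub> amap Q f"
  note p = \<psi>_Hom[OF Z] and \<phi>Z = \<phi>_Hom[OF Z] and E\<zeta> = functor_Hom[OF Eq \<zeta>]
  note Lf = lift_Hom[OF f]
  note l = cat_comp[OF R q Lf]
  note r = cat_comp[OF R f E\<zeta>]
  note g = cat_comp[OF B functor_Hom[OF Q f] \<epsilon>_Hom[OF Z]]
  note Fg = functor_Hom[OF F g]
  note e = \<eta>_Hom[OF P]
  have "amap lift f \<cdot>\<^bsub>R\<^esub> q = (\<phi> Z \<cdot>\<^bsub>R\<^esub> amap Eq \<zeta>) \<cdot>\<^bsub>R\<^esub> f \<longleftrightarrow>
      \<psi> Z \<cdot>\<^bsub>R\<^esub> (amap lift f \<cdot>\<^bsub>R\<^esub> q) = amap Eq \<zeta> \<cdot>\<^bsub>R\<^esub> f"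
  proof
    assume "amap lift f \<cdot>\<^bsub>R\<^esub> q = (\<phi> Z \<cdot>\<^bsub>R\<^esub> amap Eq \<zeta>) \<cdot>\<^bsub>R\<^esub> f"
    then show "\<psi> Z \<cdot>\<^bsub>R\<^esub> (amap lift f \<cdot>\<^bsub>R\<^esub> q) = amap Eq \<zeta> \<cdot>\<^bsub>R\<^esub> f"
      using cat_assoc[OF R f E\<zeta> \<phi>Z] cat_assoc[OF R r \<phi>Z p] \<psi>_\<phi>[OF Z] cat_idl[OF R r] by simp
  next
    assume *: "\<psi> Z \<cdot>\<^bsub>R\<^esub> (amap lift f \<cdot>\<^bsub>R\<^esub> q) = amap Eq \<zeta> \<cdot>\<^bsub>R\<^esub> f"
    show "amap lift f \<cdot>\<^bsub>R\<^esub> q = (\<phi> Z \<cdot>\<^bsub>R\<^esub> amap Eq \<zeta>) \<cdot>\<^bsub>R\<^esub> f"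
      using cat_assoc[OF R f E\<zeta> \<phi>Z] cat_assoc[OF R l p \<phi>Z] \<phi>_\<psi>[OF Z] cat_idl[OF R l] * by simp
  qed
  also have "\<psi> Z \<cdot>\<^bsub>R\<^esub> (amap lift f \<cdot>\<^bsub>R\<^esub> q) = amap Eq (amap F ?g) \<cdot>\<^bsub>R\<^esub> (amap Eq a \<cdot>\<^bsub>R\<^esub> \<eta> P)"
    using cat_assoc[OF R q Lf p] \<psi>_lift[OF f Z] a(2)
      cat_assoc[OF R q lift_map_Hom[OF P] functor_Hom[OF Eq Fg]] by simp
  also have "\<dots> = amap Eq (amap F ?g \<cdot>\<^bsub>B\<^esub> a) \<cdot>\<^bsub>R\<^esub> \<eta> P"
    using functor_comp[OF Eq a(1) Fg]
      cat_assoc[OF R e functor_Hom[OF Eq a(1)] functor_Hom[OF Eq Fg]] by simp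
  also have "amap Eq \<zeta> \<cdot>\<^bsub>R\<^esub> f = amap Eq \<zeta> \<cdot>\<^bsub>R\<^esub> (amap Eq ?g \<cdot>\<^bsub>R\<^esub> \<eta> P)"
    using transpose_inverse[OF f Z] by simp
  also have "\<dots> = amap Eq (\<zeta> \<cdot>\<^bsub>B\<^esub> ?g) \<cdot>\<^bsub>R\<^esub> \<eta> P"
    using functor_comp[OF Eq g \<zeta>] cat_assoc[OF R e functor_Hom[OF Eq g] E\<zeta>] by simp
  also have "amap Eq (amap F ?g \<cdot>\<^bsub>B\<^esub> a) \<cdot>\<^bsub>R\<^esub> \<eta> P = amap Eq (\<zeta> \<cdot>\<^bsub>B\<^esub> ?g) \<cdot>\<^bsub>R\<^esub> \<eta> P \<longleftrightarrow>
      amap F ?g \<cdot>\<^bsub>B\<^esub> a = \<zeta> \<cdot>\<^bsub>B\<^esub> ?g"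
    using transpose_inject[OF cat_comp[OF B a(1) Fg] cat_comp[OF B g \<zeta>] P] by metis
  finally show ?thesis .
qed

text \<open>Transposition matches morphisms from a coalgebra on \<open>P\<close> into the image of
  \<open>T\<close> with morphisms from an \<open>F\<close>-coalgebra on \<open>Q P\<close> into
  \<open>T\<close>, and there is exactly one of the latter.\<close>

lemma sound_coinduction_lift: "sound_coinduction_rule B R Eq F lift \<phi>"
  unfolding sound_coinduction_rule_def preserves_terminal_objects_def
proof (intro conjI allI impI)
  show G: "is_functor (Coalg B F) (Coalg R lift) (coalg_eq R Eq \<phi>)"
    using functor_coalg_eq[OF F functor_lift Eq] eq_preserving_lift
    by (simp add: eq_preserving_def natural_isomorphism_def)
  fix T assume T: "terminal_object (Coalg B F) T"
  obtain Z \<zeta> where T': "T = (Z, \<zeta>)" by (cases T)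
  have oT: "T \<in> Obj (Coalg B F)" using T by (simp add: terminal_object_def)
  then have Z: "Z \<in> Obj B" and \<zeta>: "\<zeta> \<in> Hom B Z (omap F Z)" by (auto simp: T' Coalg_Obj)
  let ?T = "omap (coalg_eq R Eq \<phi>) T"
  note oT' = functor_Obj[OF G oT]
  have "\<exists>!m. m \<in> Hom (Coalg R lift) b ?T" if ob: "b \<in> Obj (Coalg R lift)" for b
  proof -
    obtain P q where b: "b = (P, q)" by (cases b)
    have P: "P \<in> Obj R" and q: "q \<in> Hom R P (omap lift P)" using ob by (auto simp: b Coalg_Obj)
    have cq: "lift_map P \<cdot>\<^bsub>R\<^esub> q \<in> Hom R P (omap Eq (omap F (omap Q P)))"
      by (rule cat_comp[OF R q lift_map_Hom[OF P]])
    have FQ: "omap F (omap Q P) \<in> Obj B" by (intro functor_Obj[OF F] functor_Obj[OF Q] P)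
    \<comment> \<open>The transpose of \<open>lift_map P \<cdot> q\<close>; it turns
      \<open>Q P\<close> into an \<open>F\<close>-coalgebra.\<close>
    define a where "a = \<epsilon> (omap F (omap Q P)) \<cdot>\<^bsub>B\<^esub> amap Q (lift_map P \<cdot>\<^bsub>R\<^esub> q)"
    have a: "a \<in> Hom B (omap Q P) (omap F (omap Q P))"
      unfolding a_def by (rule cat_comp[OF B functor_Hom[OF Q cq] \<epsilon>_Hom[OF FQ]])
    have a\<eta>: "amap Eq a \<cdot>\<^bsub>R\<^esub> \<eta> P = lift_map P \<cdot>\<^bsub>R\<^esub> q"
      unfolding a_def by (rule transpose_inverse[OF cq FQ])
    note iff = lift_coalgebra_transpose[OF P q Z \<zeta> a a\<eta>]
    have Qa: "(omap Q P, a) \<in> Obj (Coalg B F)" using a functor_Obj[OF Q P] by (simp add: Coalg_Obj)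
    then have "\<exists>!m. m \<in> Hom (Coalg B F) (omap Q P, a) T"
      using T by (simp add: terminal_object_def)
    then have "\<exists>!g. g \<in> Hom B (omap Q P) Z \<and> amap F g \<cdot>\<^bsub>B\<^esub> a = \<zeta> \<cdot>\<^bsub>B\<^esub> g"
      using Qa oT by (auto simp: Coalg_Hom T')
    then obtain g where g: "g \<in> Hom B (omap Q P) Z" "amap F g \<cdot>\<^bsub>B\<^esub> a = \<zeta> \<cdot>\<^bsub>B\<^esub> g"
      and g_unique: "\<And>g'. g' \<in> Hom B (omap Q P) Z \<Longrightarrow> amap F g' \<cdot>\<^bsub>B\<^esub> a = \<zeta> \<cdot>\<^bsub>B\<^esub> g' \<Longrightarrow> g' = g"
      by blast
    let ?f = "amap Eq g \<cdot>\<^bsub>R\<^esub> \<eta> P"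
    have f: "?f \<in> Hom R P (omap Eq Z)" by (rule cat_comp[OF R \<eta>_Hom[OF P] functor_Hom[OF Eq g(1)]])
    show ?thesis
    proof (rule ex1I)
      show "(b, ?f, ?T) \<in> Hom (Coalg R lift) b ?T"
        using ob oT' f iff[OF f] g(2) transpose_transpose[OF g(1) P]
        by (simp add: Coalg_Hom b T' coalg_eq_simps)
    next
      fix m assume "m \<in> Hom (Coalg R lift) b ?T"
      then obtain h where m: "m = (b, h, ?T)" and h: "h \<in> Hom R P (omap Eq Z)"
        and "amap lift h \<cdot>\<^bsub>R\<^esub> q = (\<phi> Z \<cdot>\<^bsub>R\<^esub> amap Eq \<zeta>) \<cdot>\<^bsub>R\<^esub> h"
        by (auto simp: Coalg_Hom b T' coalg_eq_simps)
      \<comment> \<open>The transpose of a competitor \<open>h\<close> is a coalgebra morphism into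
        \<open>(Z, \<zeta>)\<close>, so finality identifies it with \<open>g\<close>; transposing
        back recovers \<open>h\<close>.\<close>
      with iff[OF h] have "\<epsilon> Z \<cdot>\<^bsub>B\<^esub> amap Q h = g"
        using g_unique[OF cat_comp[OF B functor_Hom[OF Q h] \<epsilon>_Hom[OF Z]]] by blast
      then show "m = (b, ?f, ?T)" using m transpose_inverse[OF h Z] by simp
    qed
  qed
  then show "terminal_object (Coalg R lift) ?T" using oT' by (simp add: terminal_object_def)
qed

end

section \<open>Products and the relations fibration\<close>

lemma pairing:
  assumes "category B" "binary_products B p" "u \<in> Hom B Z X" "v \<in> Hom B Z Y"
  shows pairing_Hom: "pairing B p u v \<in> Hom B Z (prd p X Y)"
    and pr1_pairing: "pr1 p X Y \<cdot>\<^bsub>B\<^esub> pairing B p u v = u"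
    and pr2_pairing: "pr2 p X Y \<cdot>\<^bsub>B\<^esub> pairing B p u v = v"
proof -
  have "Z \<in> Obj B" "X \<in> Obj B" "Y \<in> Obj B" using cat_Obj assms by metis+
  then have "\<exists>!h. h \<in> Hom B Z (prd p X Y) \<and> pr1 p X Y \<cdot>\<^bsub>B\<^esub> h = u \<and> pr2 p X Y \<cdot>\<^bsub>B\<^esub> h = v"
    using assms unfolding binary_products_def by blast
  from theI'[OF this] show "pairing B p u v \<in> Hom B Z (prd p X Y)"
    "pr1 p X Y \<cdot>\<^bsub>B\<^esub> pairing B p u v = u" "pr2 p X Y \<cdot>\<^bsub>B\<^esub> pairing B p u v = v"
    using assms(3,4) by (simp_all add: pairing_def Hom_iff)
qed

lemma prod_proj:
  assumes "binary_products B p" "X \<in> Obj B" "Y \<in> Obj B"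
  shows pr1_Hom: "pr1 p X Y \<in> Hom B (prd p X Y) X"
    and pr2_Hom: "pr2 p X Y \<in> Hom B (prd p X Y) Y"
  using assms unfolding binary_products_def by blast+

text \<open>Both arrows solve the universal property for the projections of \<open>h\<close>.
  Equations between arrows into squares are checked through it below.\<close>

lemma prod_eqI:
  assumes B: "category B" and p: "binary_products B p" and X: "X \<in> Obj B" and Y: "Y \<in> Obj B"
    and h: "h \<in> Hom B Z (prd p X Y)" and h': "h' \<in> Hom B Z (prd p X Y)"
    and eq: "pr1 p X Y \<cdot>\<^bsub>B\<^esub> h = pr1 p X Y \<cdot>\<^bsub>B\<^esub> h'" "pr2 p X Y \<cdot>\<^bsub>B\<^esub> h = pr2 p X Y \<cdot>\<^bsub>B\<^esub> h'"
  shows "h = h'"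
proof -
  have "\<exists>!k. k \<in> Hom B Z (prd p X Y) \<and> pr1 p X Y \<cdot>\<^bsub>B\<^esub> k = pr1 p X Y \<cdot>\<^bsub>B\<^esub> h \<and>
      pr2 p X Y \<cdot>\<^bsub>B\<^esub> k = pr2 p X Y \<cdot>\<^bsub>B\<^esub> h"
    using p X Y cat_Obj(1)[OF B h] cat_comp[OF B h pr1_Hom[OF p X Y]]
      cat_comp[OF B h pr2_Hom[OF p X Y]]
    unfolding binary_products_def by blast
  then show ?thesis using h h' eq by metis
qed

lemma square_arr:
  assumes B: "category B" and p: "binary_products B p" and f: "f \<in> Hom B X Y"
  shows square_Hom: "prod_arr B p f f \<in> Hom B (prd p X X) (prd p Y Y)"
    and pr1_square: "pr1 p Y Y \<cdot>\<^bsub>B\<^esub> prod_arr B p f f = f \<cdot>\<^bsub>B\<^esub> pr1 p X X"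
    and pr2_square: "pr2 p Y Y \<cdot>\<^bsub>B\<^esub> prod_arr B p f f = f \<cdot>\<^bsub>B\<^esub> pr2 p X X"
proof -
  note X = cat_Obj(1)[OF B f]
  note 1 = cat_comp[OF B pr1_Hom[OF p X X] f] and 2 = cat_comp[OF B pr2_Hom[OF p X X] f]
  have "prod_arr B p f f = pairing B p (f \<cdot>\<^bsub>B\<^esub> pr1 p X X) (f \<cdot>\<^bsub>B\<^esub> pr2 p X X)"
    using f by (simp add: prod_arr_def Hom_iff)
  then show "prod_arr B p f f \<in> Hom B (prd p X X) (prd p Y Y)"
    "pr1 p Y Y \<cdot>\<^bsub>B\<^esub> prod_arr B p f f = f \<cdot>\<^bsub>B\<^esub> pr1 p X X"
    "pr2 p Y Y \<cdot>\<^bsub>B\<^esub> prod_arr B p f f = f \<cdot>\<^bsub>B\<^esub> pr2 p X X"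
    using pairing[OF B p 1 2] by simp_all
qed

lemma square_comp:
  assumes B: "category B" and p: "binary_products B p"
    and f: "f \<in> Hom B X Y" and g: "g \<in> Hom B Y Z"
  shows "prod_arr B p (g \<cdot>\<^bsub>B\<^esub> f) (g \<cdot>\<^bsub>B\<^esub> f) = prod_arr B p g g \<cdot>\<^bsub>B\<^esub> prod_arr B p f f"
proof -
  note X = cat_Obj(1)[OF B f] and Y = cat_Obj[OF B g]
  note gf = cat_comp[OF B f g]
  note sf = square_Hom[OF B p f] and sg = square_Hom[OF B p g]
  show ?thesis
  proof (rule prod_eqI[OF B p Y(2) Y(2) square_Hom[OF B p gf] cat_comp[OF B sf sg]])
    show "pr1 p Z Z \<cdot>\<^bsub>B\<^esub> prod_arr B p (g \<cdot>\<^bsub>B\<^esub> f) (g \<cdot>\<^bsub>B\<^esub> f) =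
        pr1 p Z Z \<cdot>\<^bsub>B\<^esub> prod_arr B p g g \<cdot>\<^bsub>B\<^esub> prod_arr B p f f"
      using pr1_square[OF B p gf] cat_assoc[OF B sf sg pr1_Hom[OF p Y(2) Y(2)]]
        pr1_square[OF B p g] cat_assoc[OF B sf pr1_Hom[OF p Y(1) Y(1)] g]
        pr1_square[OF B p f] cat_assoc[OF B pr1_Hom[OF p X X] f g] by simp
    show "pr2 p Z Z \<cdot>\<^bsub>B\<^esub> prod_arr B p (g \<cdot>\<^bsub>B\<^esub> f) (g \<cdot>\<^bsub>B\<^esub> f) =
        pr2 p Z Z \<cdot>\<^bsub>B\<^esub> prod_arr B p g g \<cdot>\<^bsub>B\<^esub> prod_arr B p f f"
      using pr2_square[OF B p gf] cat_assoc[OF B sf sg pr2_Hom[OF p Y(2) Y(2)]]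
        pr2_square[OF B p g] cat_assoc[OF B sf pr2_Hom[OF p Y(1) Y(1)] g]
        pr2_square[OF B p f] cat_assoc[OF B pr2_Hom[OF p X X] f g] by simp
  qed
qed

lemma diag:
  assumes B: "category B" and p: "binary_products B p" and X: "X \<in> Obj B"
  shows diag_Hom: "diag B p X \<in> Hom B X (prd p X X)"
    and pr1_diag: "pr1 p X X \<cdot>\<^bsub>B\<^esub> diag B p X = Idn B X"
    and pr2_diag: "pr2 p X X \<cdot>\<^bsub>B\<^esub> diag B p X = Idn B X"
  using pairing[OF B p cat_Idn[OF B X] cat_Idn[OF B X]] by (simp_all add: diag_def)

text \<open>Under either projection both sides reduce to \<open>f\<close>. This naturality of the
  diagonal links arrows above \<open>prod_arr B p f f\<close> with arrows above
  \<open>f\<close>.\<close>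

lemma diag_square:
  assumes B: "category B" and p: "binary_products B p" and f: "f \<in> Hom B X Y"
  shows "prod_arr B p f f \<cdot>\<^bsub>B\<^esub> diag B p X = diag B p Y \<cdot>\<^bsub>B\<^esub> f"
proof -
  note X = cat_Obj[OF B f]
  note dX = diag_Hom[OF B p X(1)] and dY = diag_Hom[OF B p X(2)]
  note sf = square_Hom[OF B p f]
  show ?thesis
  proof (rule prod_eqI[OF B p X(2) X(2) cat_comp[OF B dX sf] cat_comp[OF B f dY]])
    show "pr1 p Y Y \<cdot>\<^bsub>B\<^esub> prod_arr B p f f \<cdot>\<^bsub>B\<^esub> diag B p X = pr1 p Y Y \<cdot>\<^bsub>B\<^esub> diag B p Y \<cdot>\<^bsub>B\<^esub> f"
      using cat_assoc[OF B dX sf pr1_Hom[OF p X(2) X(2)]] pr1_square[OF B p f]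
        cat_assoc[OF B dX pr1_Hom[OF p X(1) X(1)] f] pr1_diag[OF B p X(1)] cat_idr[OF B f]
        cat_assoc[OF B f dY pr1_Hom[OF p X(2) X(2)]] pr1_diag[OF B p X(2)] cat_idl[OF B f] by simp
    show "pr2 p Y Y \<cdot>\<^bsub>B\<^esub> prod_arr B p f f \<cdot>\<^bsub>B\<^esub> diag B p X = pr2 p Y Y \<cdot>\<^bsub>B\<^esub> diag B p Y \<cdot>\<^bsub>B\<^esub> f"
      using cat_assoc[OF B dX sf pr2_Hom[OF p X(2) X(2)]] pr2_square[OF B p f]
        cat_assoc[OF B dX pr2_Hom[OF p X(1) X(1)] f] pr2_diag[OF B p X(1)] cat_idr[OF B f]
        cat_assoc[OF B f dY pr2_Hom[OF p X(2) X(2)]] pr2_diag[OF B p X(2)] cat_idl[OF B f] by simp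
  qed
qed

text \<open>The first projection is a left inverse of the diagonal, so the diagonal is monic and its
  kernel pair consists of identities. Beck-Chevalley is applied to this square.\<close>

lemma diag_pullback:
  assumes B: "category B" and p: "binary_products B p" and X: "X \<in> Obj B"
  shows "is_pullback B (diag B p X) (diag B p X) (Idn B X) (Idn B X)"
proof -
  note d = diag_Hom[OF B p X] and i = cat_Idn[OF B X] and p1 = pr1_Hom[OF p X X]
  have mono: "u = v" if "u \<in> Hom B Z X" "v \<in> Hom B Z X" "diag B p X \<cdot>\<^bsub>B\<^esub> u = diag B p X \<cdot>\<^bsub>B\<^esub> v"
    for Z u v
    using cat_assoc[OF B that(1) d p1] cat_assoc[OF B that(2) d p1] that(3)
      pr1_diag[OF B p X] cat_idl[OF B that(1)] cat_idl[OF B that(2)] by simp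
  have "\<exists>!h. h \<in> Hom B Z X \<and> Idn B X \<cdot>\<^bsub>B\<^esub> h = u \<and> Idn B X \<cdot>\<^bsub>B\<^esub> h = v"
    if "u \<in> Hom B Z X" "v \<in> Hom B Z X" "diag B p X \<cdot>\<^bsub>B\<^esub> u = diag B p X \<cdot>\<^bsub>B\<^esub> v" for Z u v
    using mono[OF that] that(1) cat_idl[OF B] by metis
  moreover have "Dom B (diag B p X) = X" "Dom B (Idn B X) = X" "diag B p X \<in> Arr B"
    using d i by (simp_all add: Hom_iff)
  ultimately show ?thesis using i unfolding is_pullback_def by simp
qed

section \<open>The category of relations and its fibration\<close>

lemma Rel_cat_simps:
  "(X, P) \<in> Obj (Rel_cat E B U p) \<longleftrightarrow> X \<in> Obj B \<and> P \<in> Obj E \<and> omap U P = prd p X X"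
  "(f, g) \<in> Hom (Rel_cat E B U p) (X, P) (Y, S) \<longleftrightarrow>
     f \<in> Hom B X Y \<and> g \<in> Hom E P S \<and> amap U g = prod_arr B p f f"
  "Idn (Rel_cat E B U p) (X, P) = (Idn B X, Idn E P)"
  "(f', g') \<cdot>\<^bsub>Rel_cat E B U p\<^esub> (f, g) = (f' \<cdot>\<^bsub>B\<^esub> f, g' \<cdot>\<^bsub>E\<^esub> g)"
  by (auto simp: Rel_cat_def base_change_cat_def square_functor_def Hom_iff)

lemma functor_Rel_fibration:
  assumes "category (Rel_cat E B U p)" "category B"
  shows "is_functor (Rel_cat E B U p) B Rel_fibration"
  by (rule functorI[OF assms])
    (auto simp: Rel_cat_simps base_change_functor_def)

text \<open>Fibrations are stable under change of base. The cartesian arrow above \<open>f\<close>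
  is \<open>(f, g)\<close> with \<open>g\<close> cartesian above the square of \<open>f\<close>; a
  factorisation over \<open>v\<close> pairs \<open>v\<close> with a factorisation through
  \<open>g\<close> over the square of \<open>v\<close>, and \<open>square_comp\<close> makes the two
  compatible.\<close>

lemma fibration_Rel:
  assumes R: "category (Rel_cat E B U p)" and U: "fibration E B U" and p: "binary_products B p"
  shows "fibration (Rel_cat E B U p) B Rel_fibration"
proof -
  let ?R = "Rel_cat E B U p"
  have U': "is_functor E B U" using U by (simp add: fibration_def)
  note B = functor_cat(2)[OF U'] and E = functor_cat(1)[OF U']
  have "\<exists>m. Cod ?R m = (Y, P) \<and> cartesian ?R B Rel_fibration f m"
    if P: "(Y, P) \<in> Obj ?R" and f: "f \<in> Hom B X Y" for Y P f X
  proof -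
    note sf = square_Hom[OF B p f]
    obtain g where g: "Cod E g = P" "cartesian E B U (prod_arr B p f f) g"
      using U[unfolded fibration_def, THEN conjunct2, rule_format, of P "prod_arr B p f f"] P sf
      unfolding Rel_cat_simps Hom_iff by auto
    define S where "S = Dom E g"
    have gH: "g \<in> Hom E S P" and Ug: "amap U g = prod_arr B p f f"
      using g by (auto simp: cartesian_def Hom_iff S_def)
    have US: "omap U S = prd p X X" using functor_Hom[OF U' gH] sf Ug by (simp add: Hom_iff)
    have m: "(f, g) \<in> Hom ?R (X, S) (Y, P)" using f gH Ug by (simp add: Rel_cat_simps)
    have "cartesian ?R B Rel_fibration f (f, g)"
      unfolding cartesian_def
    proof (intro conjI allI impI)
      show "(f, g) \<in> Arr ?R" "f \<in> Arr B" using m f by (simp_all add: Hom_iff)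
      show "amap Rel_fibration (f, g) = f" by (simp add: base_change_functor_def)
      fix m' v
      assume m': "m' \<in> Arr ?R" "Cod ?R m' = Cod ?R (f, g)"
        and v: "v \<in> Hom B (omap Rel_fibration (Dom ?R m')) (Dom B f)"
        and eq: "amap Rel_fibration m' = f \<cdot>\<^bsub>B\<^esub> v"
      obtain f' g' where m'': "m' = (f', g')" by (cases m')
      obtain W T where D: "Dom ?R m' = (W, T)" by (cases "Dom ?R m'")
      have mH: "(f', g') \<in> Hom ?R (W, T) (Y, P)"
        using m' m D by (simp add: Hom_iff m'')
      then have f': "f' \<in> Hom B W Y" and g': "g' \<in> Hom E T P" and Ug': "amap U g' = prod_arr B p f' f'"
        by (simp_all add: Rel_cat_simps)
      have UT: "omap U T = prd p W W" using cat_Obj(1)[OF R mH] by (simp add: Rel_cat_simps)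
      have vH: "v \<in> Hom B W X" using v f D by (simp add: base_change_functor_def Hom_iff)
      have "f' = f \<cdot>\<^bsub>B\<^esub> v" using eq by (simp add: m'' base_change_functor_def)
      then have e: "amap U g' = prod_arr B p f f \<cdot>\<^bsub>B\<^esub> prod_arr B p v v"
        using Ug' square_comp[OF B p vH f] by simp
      have sv: "prod_arr B p v v \<in> Hom B (omap U T) (omap U S)"
        using square_Hom[OF B p vH] UT US by simp
      have ex1: "\<exists>!h. h \<in> Hom E T S \<and> amap U h = prod_arr B p v v \<and> g \<cdot>\<^bsub>E\<^esub> h = g'"
        by (rule cartesian_ex1[OF U' g(2) gH g' sv e])
      then obtain h where h: "h \<in> Hom E T S" "amap U h = prod_arr B p v v" "g \<cdot>\<^bsub>E\<^esub> h = g'" by blast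
      have DS: "Dom ?R (f, g) = (X, S)" using m by (simp add: Hom_iff)
      show "\<exists>!k. k \<in> Hom ?R (Dom ?R m') (Dom ?R (f, g)) \<and> amap Rel_fibration k = v \<and>
          (f, g) \<cdot>\<^bsub>?R\<^esub> k = m'"
      proof (rule ex1I)
        show "(v, h) \<in> Hom ?R (Dom ?R m') (Dom ?R (f, g)) \<and> amap Rel_fibration (v, h) = v \<and>
            (f, g) \<cdot>\<^bsub>?R\<^esub> (v, h) = m'"
          using h vH eq unfolding D DS by (simp add: Rel_cat_simps base_change_functor_def m'')
      next
        fix k assume k: "k \<in> Hom ?R (Dom ?R m') (Dom ?R (f, g)) \<and> amap Rel_fibration k = v \<and>
            (f, g) \<cdot>\<^bsub>?R\<^esub> k = m'"
        obtain v' h' where k': "k = (v', h')" by (cases k)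
        have v': "v' = v" using k by (simp add: k' base_change_functor_def)
        have "h' \<in> Hom E T S \<and> amap U h' = prod_arr B p v v \<and> g \<cdot>\<^bsub>E\<^esub> h' = g'"
          using k unfolding D DS by (simp add: k' v' m'' Rel_cat_simps)
        then show "k = (v, h)" using ex1 h k' v' by blast
      qed
    qed
    then show ?thesis using m by (auto simp: Hom_iff)
  qed
  then have "\<exists>m. Cod ?R m = P \<and> cartesian ?R B Rel_fibration f m"
    if "P \<in> Obj ?R" "f \<in> Arr B" "Cod B f = omap Rel_fibration P" for P f
    using that Arr_Hom[OF that(2)] by (cases P) (auto simp: base_change_functor_def)
  then show ?thesis using functor_Rel_fibration[OF R B] unfolding fibration_def by blast
qed

section \<open>Fibres and fullness of equality\<close>

lemma fibre_simps:
  "P \<in> Obj (fibre E B U X) \<longleftrightarrow> P \<in> Obj E \<and> omap U P = X"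
  "Hom (fibre E B U X) P S = {g \<in> Hom E P S. amap U g = Idn B X}"
  "Idn (fibre E B U X) = Idn E" "Cmp (fibre E B U X) = Cmp E"
  "Dom (fibre E B U X) = Dom E" "Cod (fibre E B U X) = Cod E"
  by (auto simp: fibre_def Hom_def)

lemma category_fibre:
  assumes U: "is_functor E B U" and X: "X \<in> Obj B"
  shows "category (fibre E B U X)"
proof (rule categoryI)
  note E = functor_cat(1)[OF U] and B = functor_cat(2)[OF U]
  note i = cat_Idn[OF B X]
  {
    fix P S g assume "g \<in> Hom (fibre E B U X) P S"
    then have g: "g \<in> Hom E P S" "amap U g = Idn B X" by (simp_all add: fibre_simps)
    show "P \<in> Obj (fibre E B U X) \<and> S \<in> Obj (fibre E B U X)"
      using functor_Hom[OF U g(1)] g(2) i cat_Obj[OF E g(1)] by (simp add: fibre_simps Hom_iff)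
    show "g \<cdot>\<^bsub>fibre E B U X\<^esub> Idn (fibre E B U X) P = g" "Idn (fibre E B U X) S \<cdot>\<^bsub>fibre E B U X\<^esub> g = g"
      using cat_idl[OF E g(1)] cat_idr[OF E g(1)] by (simp_all add: fibre_simps)
  next
    fix P assume "P \<in> Obj (fibre E B U X)"
    then show "Idn (fibre E B U X) P \<in> Hom (fibre E B U X) P P"
      using cat_Idn[OF E] functor_Idn[OF U] by (simp add: fibre_simps)
  next
    fix P S T f g assume "f \<in> Hom (fibre E B U X) P S" "g \<in> Hom (fibre E B U X) S T"
    then have f: "f \<in> Hom E P S" "amap U f = Idn B X" and g: "g \<in> Hom E S T" "amap U g = Idn B X"
      by (simp_all add: fibre_simps)
    show "g \<cdot>\<^bsub>fibre E B U X\<^esub> f \<in> Hom (fibre E B U X) P T"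
      using cat_comp[OF E f(1) g(1)] functor_comp[OF U f(1) g(1)] f(2) g(2) cat_idl[OF B i]
      by (simp add: fibre_simps)
  next
    fix P S T W f g h
    assume "f \<in> Hom (fibre E B U X) P S" "g \<in> Hom (fibre E B U X) S T" "h \<in> Hom (fibre E B U X) T W"
    then show "(h \<cdot>\<^bsub>fibre E B U X\<^esub> g) \<cdot>\<^bsub>fibre E B U X\<^esub> f = h \<cdot>\<^bsub>fibre E B U X\<^esub> (g \<cdot>\<^bsub>fibre E B U X\<^esub> f)"
      using cat_assoc[OF E, of f P S g T h W] by (simp add: fibre_simps)
  }
qed

lemma reindex_cartesian:
  assumes U: "is_functor E B U" and cl: "cleavage E B U cl"
    and P: "P \<in> Obj E" and f: "f \<in> Hom B X (omap U P)"
  shows "cl f P \<in> Hom E (omap (reindex E B U cl f) P) P"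
    and "cartesian E B U f (cl f P)"
    and "omap U (omap (reindex E B U cl f) P) = X"
    and "omap (reindex E B U cl f) P \<in> Obj E"
proof -
  have *: "Cod E (cl f P) = P" "cartesian E B U f (cl f P)"
    using cl P f by (auto simp: cleavage_def Hom_iff)
  then show h: "cl f P \<in> Hom E (omap (reindex E B U cl f) P) P" "cartesian E B U f (cl f P)"
    by (auto simp: reindex_def Hom_iff cartesian_def)
  show "omap U (omap (reindex E B U cl f) P) = X"
    using functor_Hom[OF U h(1)] h(2) f by (simp add: cartesian_def Hom_iff)
  show "omap (reindex E B U cl f) P \<in> Obj E"
    using cat_Obj(1)[OF functor_cat(1)[OF U] h(1)] .
qed

section \<open>Opcartesian arrows by duality\<close>

lemma opp_simps:
  "Obj (opp C) = Obj C" "Hom (opp C) X Y = Hom C Y X" "Cmp (opp C) g f = Cmp C f g"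
  by (auto simp: opp_def Hom_def)

lemma opreindex_opcartesian:
  assumes U: "is_functor (opp E) (opp B) U" and ocl: "opcleavage E B U ocl"
    and P: "P \<in> Obj E" and f: "f \<in> Hom B (omap U P) Y"
  shows "ocl f P \<in> Hom E P (omap (opreindex E B U ocl f) P)"
    and "cartesian (opp E) (opp B) U f (ocl f P)"
    and "omap U (omap (opreindex E B U ocl f) P) = Y"
    and "omap (opreindex E B U ocl f) P \<in> Obj E"
  using reindex_cartesian[OF U ocl[unfolded opcleavage_def], of P f Y] P f
  by (simp_all add: opp_simps opreindex_def)

lemma opcartesian_ex1:
  assumes "is_functor (opp E) (opp B) U" "cartesian (opp E) (opp B) U f g"
    and "g \<in> Hom E P S" "g' \<in> Hom E P T"
    and "v \<in> Hom B (omap U S) (omap U T)" "amap U g' = v \<cdot>\<^bsub>B\<^esub> f"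
  shows "\<exists>!h. h \<in> Hom E S T \<and> amap U h = v \<and> h \<cdot>\<^bsub>E\<^esub> g = g'"
  using cartesian_ex1[OF assms(1,2), of S P g' T v] assms by (simp add: opp_simps)

lemma opcartesian_unique:
  assumes "is_functor (opp E) (opp B) U" "cartesian (opp E) (opp B) U f g"
    and "g \<in> Hom E P S" "h \<in> Hom E S T" "h' \<in> Hom E S T"
    and "amap U h = amap U h'" "h \<cdot>\<^bsub>E\<^esub> g = h' \<cdot>\<^bsub>E\<^esub> g"
  shows "h = h'"
  using cartesian_unique[OF assms(1,2), of S P h T h'] assms by (simp add: opp_simps)

locale equality_bifibration =
  fixes E :: "('eo, 'ea) cat" and B :: "('bo, 'ba) cat"
    and U :: "('eo, 'ea, 'bo, 'ba) fctr"
    and cl ocl :: "'ba \<Rightarrow> 'eo \<Rightarrow> 'ea"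
    and p :: "('bo, 'ba) prod_data"
    and K :: "('bo, 'ba, 'eo, 'ea) fctr"
  assumes bifib: "bifibration E B U"
    and cl: "cleavage E B U cl" and ocl: "opcleavage E B U ocl"
    and bc: "beck_chevalley E B U cl ocl"
    and p: "binary_products B p"
    and K: "truth_functor E B U cl K"
begin

lemma U: "is_functor E B U" and opU: "is_functor (opp E) (opp B) U"
  using bifib by (simp_all add: bifibration_def fibration_def opfibration_def)

lemmas E = functor_cat(1)[OF U] and B = functor_cat(2)[OF U]

text \<open>Factoring the identity of \<open>P\<close> through the opcartesian arrow
  \<open>?o\<close> gives a vertical left inverse \<open>r\<close>. The other composite agrees with
  the identity after composition with \<open>?o\<close>, hence equals it by opcartesian
  uniqueness.\<close>

lemma opreindex_Idn_iso:
  assumes P: "P \<in> Obj E"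
  shows "is_iso (fibre E B U (omap U P)) (ocl (Idn B (omap U P)) P)"
proof -
  let ?X = "omap U P" and ?S = "omap (opreindex E B U ocl (Idn B (omap U P))) P"
  let ?o = "ocl (Idn B (omap U P)) P"
  note i = cat_Idn[OF B functor_Obj[OF U P]]
  note o = opreindex_opcartesian[OF opU ocl P i]
  have Uo: "amap U ?o = Idn B ?X" using o(2) by (simp add: cartesian_def)
  have "Idn B ?X \<in> Hom B (omap U ?S) (omap U P)" using i o(3) by simp
  moreover have "amap U (Idn E P) = Idn B ?X \<cdot>\<^bsub>B\<^esub> Idn B ?X"
    using functor_Idn[OF U P] cat_idl[OF B i] by simp
  ultimately obtain r where r: "r \<in> Hom E ?S P" "amap U r = Idn B ?X" "r \<cdot>\<^bsub>E\<^esub> ?o = Idn E P"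
    using opcartesian_ex1[OF opU o(2,1) cat_Idn[OF E P]] by blast
  have "?o \<cdot>\<^bsub>E\<^esub> r = Idn E ?S"
  proof (rule opcartesian_unique[OF opU o(2,1) cat_comp[OF E r(1) o(1)] cat_Idn[OF E o(4)]])
    show "amap U (?o \<cdot>\<^bsub>E\<^esub> r) = amap U (Idn E ?S)"
      using functor_comp[OF U r(1) o(1)] r(2) Uo functor_Idn[OF U o(4)] o(3) cat_idl[OF B i] by simp
    show "(?o \<cdot>\<^bsub>E\<^esub> r) \<cdot>\<^bsub>E\<^esub> ?o = Idn E ?S \<cdot>\<^bsub>E\<^esub> ?o"
      using cat_assoc[OF E o(1) r(1) o(1)] r(3) cat_idl[OF E o(1)] cat_idr[OF E o(1)] by simp
  qed
  moreover have "?o \<in> Arr (fibre E B U ?X)" "Dom E ?o = P" "Cod E ?o = ?S"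
    using o(1) Uo by (simp_all add: fibre_def Hom_iff)
  ultimately show ?thesis
    unfolding is_iso_def using r by (intro conjI bexI[of _ r]) (simp_all add: fibre_simps)
qed

lemma terminal_reindex:
  "f \<in> Hom B X Y \<Longrightarrow> terminal_object (fibre E B U Y) T \<Longrightarrow>
    terminal_object (fibre E B U X) (omap (reindex E B U cl f) T)"
  using K unfolding truth_functor_def Hom_iff by blast

section \<open>Equality objects and the arrows between them\<close>

abbreviation \<Sigma>K :: "'bo \<Rightarrow> 'eo" where
  "\<Sigma>K X \<equiv> omap (opreindex E B U ocl (diag B p X)) (omap K X)"

lemma K_Obj:
  assumes X: "X \<in> Obj B"
  shows "omap K X \<in> Obj E" "omap U (omap K X) = X"
  using K X by (auto simp: truth_functor_def terminal_object_def fibre_simps)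

lemma K_diag: "X \<in> Obj B \<Longrightarrow> diag B p X \<in> Hom B (omap U (omap K X)) (prd p X X)"
  using diag_Hom[OF B p] K_Obj by simp

lemmas \<Sigma>K_opcartesian = opreindex_opcartesian[OF opU ocl K_Obj(1) K_diag]

text \<open>As \<open>\<delta>\<close> is a monomorphism, its kernel pair is trivial and the Beck-Chevalley condition gives
  \<open>\<delta>\<^sup>* \<Sigma>\<^sub>\<delta> K \<cong> K\<close>.\<close>

lemma terminal_reindex_\<Sigma>K:
  assumes X: "X \<in> Obj B"
  shows "terminal_object (fibre E B U X) (omap (reindex E B U cl (diag B p X)) (\<Sigma>K X))"
proof -
  let ?f = "fibre E B U X" and ?d = "diag B p X" and ?i = "Idn B X"
  let ?P = "omap (reindex E B U cl ?i) (omap K X)"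
  let ?b = "beck_chevalley_map E B U cl ocl ?d ?d ?i ?i (omap K X)"
  note d = diag_Hom[OF B p X] and i = cat_Idn[OF B X] and C = category_fibre[OF U X]
  have "terminal_object ?f (omap K X)" using K X by (simp add: truth_functor_def)
  \<comment> \<open>The Beck-Chevalley map starts at the opreindexing of \<open>?P\<close> along the
    identity, which need not be \<open>omap K X\<close> itself. Terminality reaches it in two moves:
    reindexing preserves terminal objects, and the opcartesian arrow above the identity is
    invertible.\<close>
  then have P: "terminal_object ?f ?P" by (rule terminal_reindex[OF i])
  then have P': "?P \<in> Obj E" "omap U ?P = X" by (auto simp: terminal_object_def fibre_simps)
  have o: "ocl ?i ?P \<in> Hom E ?P (omap (opreindex E B U ocl ?i) ?P)"
    using opreindex_opcartesian(1)[OF opU ocl P'(1)] i P'(2) by simp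
  have "terminal_object ?f (Cod ?f (ocl ?i ?P))"
    using terminal_object_iso[OF C P, of "ocl ?i ?P"] opreindex_Idn_iso[OF P'(1)] o P'(2)
    by (simp add: fibre_simps Hom_iff)
  then have S: "terminal_object ?f (omap (opreindex E B U ocl ?i) ?P)"
    using o by (simp add: fibre_simps Hom_iff)
  have "natural_isomorphism ?f ?f (opreindex E B U ocl ?i \<circ>\<^sub>F reindex E B U cl ?i)
      (reindex E B U cl ?d \<circ>\<^sub>F opreindex E B U ocl ?d)
      (beck_chevalley_map E B U cl ocl ?d ?d ?i ?i)"
    using bc[unfolded beck_chevalley_def, rule_format, OF diag_pullback[OF B p X]] d
    by (simp add: Hom_iff)
  moreover have "omap K X \<in> Obj ?f" using K_Obj[OF X] by (simp add: fibre_simps)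
  ultimately have b: "?b \<in> Hom ?f (omap (opreindex E B U ocl ?i) ?P)
      (omap (reindex E B U cl ?d) (\<Sigma>K X))" and iso: "is_iso ?f ?b"
    by (simp_all add: natural_isomorphism_def natural_transformation_def)
  show ?thesis using terminal_object_iso[OF C S iso] b by (simp add: Hom_iff)
qed

text \<open>An arrow out of \<open>\<Sigma>K X\<close> above a given base arrow is determined by its
  composite with the opcartesian \<open>?o\<close>. That composite corresponds to a vertical arrow
  from \<open>omap K X\<close> into an object obtained by reindexing \<open>\<Sigma>K Y\<close>
  along the diagonal and then \<open>f\<close>, which is terminal in its fibre.\<close>

lemma eq_arrow_unique:
  assumes f: "f \<in> Hom B X Y"
    and g: "g \<in> Hom E (\<Sigma>K X) (\<Sigma>K Y)" "amap U g = prod_arr B p f f"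
    and g': "g' \<in> Hom E (\<Sigma>K X) (\<Sigma>K Y)" "amap U g' = prod_arr B p f f"
  shows "g = g'"
proof -
  note X = cat_Obj[OF B f]
  note KX = K_Obj[OF X(1)]
  note o = \<Sigma>K_opcartesian[OF X(1) X(1)] and oY = \<Sigma>K_opcartesian[OF X(2) X(2)]
  let ?o = "ocl (diag B p X) (omap K X)"
  let ?d = "diag B p Y"
  let ?D = "omap (reindex E B U cl ?d) (\<Sigma>K Y)"
  have dY: "?d \<in> Hom B Y (omap U (\<Sigma>K Y))" using diag_Hom[OF B p X(2)] oY(3) by simp
  note D = reindex_cartesian[OF U cl oY(4) dY]
  have fD: "f \<in> Hom B X (omap U ?D)" using f D(3) by simp
  note G = reindex_cartesian[OF U cl D(4) fD]
  have fU: "f \<in> Hom B (omap U (omap K X)) (omap U ?D)" using f D(3) KX(2) by simp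
  have "terminal_object (fibre E B U X) (omap (reindex E B U cl f) ?D)"
    by (rule terminal_reindex[OF f terminal_reindex_\<Sigma>K[OF X(2)]])
  moreover have "omap K X \<in> Obj (fibre E B U X)" using KX by (simp add: fibre_simps)
  ultimately have uniq: "k = k'"
    if "k \<in> Hom E (omap K X) (omap (reindex E B U cl f) ?D)" "amap U k = Idn B X"
      "k' \<in> Hom E (omap K X) (omap (reindex E B U cl f) ?D)" "amap U k' = Idn B X" for k k'
    using that unfolding terminal_object_def fibre_simps(2) by blast
  have factor: "\<exists>k. k \<in> Hom E (omap K X) (omap (reindex E B U cl f) ?D) \<and> amap U k = Idn B X \<and>
      cl ?d (\<Sigma>K Y) \<cdot>\<^bsub>E\<^esub> (cl f ?D \<cdot>\<^bsub>E\<^esub> k) = m \<cdot>\<^bsub>E\<^esub> ?o"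
    if m: "m \<in> Hom E (\<Sigma>K X) (\<Sigma>K Y)" "amap U m = prod_arr B p f f" for m
  proof -
    have "amap U ?o = diag B p X" using o(2) by (simp add: cartesian_def)
    then have "amap U (m \<cdot>\<^bsub>E\<^esub> ?o) = ?d \<cdot>\<^bsub>B\<^esub> f"
      using functor_comp[OF U o(1) m(1)] m(2) diag_square[OF B p f] by simp
    \<comment> \<open>Factorisation in two stages: the cartesian arrow above the diagonal leaves an
      arrow \<open>h\<close> above \<open>f\<close>, and the one above \<open>f\<close> then leaves
      a vertical arrow.\<close>
    then obtain h where h: "h \<in> Hom E (omap K X) ?D" "amap U h = f"
        "cl ?d (\<Sigma>K Y) \<cdot>\<^bsub>E\<^esub> h = m \<cdot>\<^bsub>E\<^esub> ?o"
      using cartesian_ex1[OF U D(2,1) cat_comp[OF E o(1) m(1)] fU] by blast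
    have "Idn B X \<in> Hom B (omap U (omap K X)) (omap U (omap (reindex E B U cl f) ?D))"
      using cat_Idn[OF B X(1)] KX(2) G(3) by simp
    moreover have "amap U h = f \<cdot>\<^bsub>B\<^esub> Idn B X" using h(2) cat_idr[OF B f] by simp
    ultimately show ?thesis using cartesian_ex1[OF U G(2,1) h(1)] h(3) by blast
  qed
  obtain k where k: "k \<in> Hom E (omap K X) (omap (reindex E B U cl f) ?D)" "amap U k = Idn B X"
      "cl ?d (\<Sigma>K Y) \<cdot>\<^bsub>E\<^esub> (cl f ?D \<cdot>\<^bsub>E\<^esub> k) = g \<cdot>\<^bsub>E\<^esub> ?o"
    using factor[OF g] by blast
  obtain k' where k': "k' \<in> Hom E (omap K X) (omap (reindex E B U cl f) ?D)" "amap U k' = Idn B X"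
      "cl ?d (\<Sigma>K Y) \<cdot>\<^bsub>E\<^esub> (cl f ?D \<cdot>\<^bsub>E\<^esub> k') = g' \<cdot>\<^bsub>E\<^esub> ?o"
    using factor[OF g'] by blast
  have "g \<cdot>\<^bsub>E\<^esub> ?o = g' \<cdot>\<^bsub>E\<^esub> ?o" using k(3) k'(3) uniq[OF k(1,2) k'(1,2)] by simp
  then show ?thesis using opcartesian_unique[OF opU o(2,1) g(1) g'(1)] g(2) g'(2) by simp
qed

lemma eq_functor_simps:
  "omap (eq_functor E B U p ocl K) X = (X, \<Sigma>K X)"
  "fst (amap (eq_functor E B U p ocl K) f) = f"
  by (simp_all add: eq_functor_def Let_def)

text \<open>\<open>Eq\<close> leaves base components unchanged, so \<open>u\<close> and
  \<open>Eq (fst u)\<close> lie above the same arrow, and \<open>eq_arrow_unique\<close> identifies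
  their components in \<open>E\<close>.\<close>

lemma eq_functor_full:
  assumes Eq: "is_functor B (Rel_cat E B U p) (eq_functor E B U p ocl K)"
    and u: "u \<in> Hom (Rel_cat E B U p) (omap (eq_functor E B U p ocl K) X)
      (omap (eq_functor E B U p ocl K) Y)"
  shows "u = amap (eq_functor E B U p ocl K) (fst u)"
proof -
  obtain f g where u': "u = (f, g)" by (cases u)
  then have f: "f \<in> Hom B X Y" and g: "g \<in> Hom E (\<Sigma>K X) (\<Sigma>K Y)" "amap U g = prod_arr B p f f"
    using u by (simp_all add: eq_functor_simps Rel_cat_simps)
  obtain g' where Ef: "amap (eq_functor E B U p ocl K) f = (f, g')"
    using eq_functor_simps(2)[of f] by (cases "amap (eq_functor E B U p ocl K) f") simp
  then have "(f, g') \<in> Hom (Rel_cat E B U p) (X, \<Sigma>K X) (Y, \<Sigma>K Y)"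
    using functor_Hom[OF Eq f] by (simp add: eq_functor_simps)
  then have "g = g'" using eq_arrow_unique[OF f g] by (simp add: Rel_cat_simps)
  then show ?thesis by (simp add: u' Ef)
qed

end

theorem theorem3p10:
  fixes E :: "('eo, 'ea) cat" and B :: "('bo, 'ba) cat"
    and U :: "('eo, 'ea, 'bo, 'ba) fctr"
    and cl ocl :: "'ba \<Rightarrow> 'eo \<Rightarrow> 'ea"
    and p :: "('bo, 'ba) prod_data"
    and K :: "('bo, 'ba, 'eo, 'ea) fctr"
    and Q :: "('bo \<times> 'eo, 'ba \<times> 'ea, 'bo, 'ba) fctr"
    and F :: "('bo, 'ba, 'bo, 'ba) fctr"
    and nuF :: 'bo and \<zeta> :: 'ba
  assumes "bifibration E B U"
    and "cleavage E B U cl" and "opcleavage E B U ocl"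
    and "beck_chevalley E B U cl ocl"
    and "binary_products B p"
    and "truth_functor E B U cl K"
    and "left_adjoint (Rel_cat E B U p) B Q (eq_functor E B U p ocl K)"
    and "is_functor B B F"
    and "terminal_object (Coalg B F) (nuF, \<zeta>)"
  shows "\<exists>F' \<phi>. is_lifting (Rel_cat E B U p) Rel_fibration F F' \<and>
           eq_preserving B (Rel_cat E B U p) (eq_functor E B U p ocl K) F F' \<phi> \<and>
           sound_coinduction_rule B (Rel_cat E B U p) (eq_functor E B U p ocl K) F F' \<phi>"
proof -
  interpret equality_bifibration E B U cl ocl p K
    by unfold_locales (fact assms)+
  let ?R = "Rel_cat E B U p" and ?Eq = "eq_functor E B U p ocl K"
  obtain \<eta> \<epsilon> where adj: "is_functor ?R B Q" "is_functor B ?R ?Eq"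
      "natural_transformation ?R ?R fid (?Eq \<circ>\<^sub>F Q) \<eta>"
      "natural_transformation B B (Q \<circ>\<^sub>F ?Eq) fid \<epsilon>"
      "\<forall>P\<in>Obj ?R. \<epsilon> (omap Q P) \<cdot>\<^bsub>B\<^esub> amap Q (\<eta> P) = Idn B (omap Q P)"
      "\<forall>X\<in>Obj B. amap ?Eq (\<epsilon> X) \<cdot>\<^bsub>?R\<^esub> \<eta> (omap ?Eq X) = Idn ?R (omap ?Eq X)"
    using assms(7) unfolding left_adjoint_def by blast
  have "fibration E B U" using assms(1) by (simp add: bifibration_def)
  \<comment> \<open>That the relations form a category is contained in the functoriality of
    \<open>Q\<close>.\<close>
  then have fib: "fibration ?R B Rel_fibration"
    by (rule fibration_Rel[OF functor_cat(1)[OF adj(1)] _ p])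
  \<comment> \<open>The two conditions checked by hand are that \<open>Eq\<close> is a section of
    the relations fibration and that it is full; the rest is the unpacked adjunction, the fibration
    property and the functor \<open>F\<close>.\<close>
  interpret full_equality ?R B Rel_fibration ?Eq Q \<eta> \<epsilon> F
  proof
    show "functor_eq B (Rel_fibration \<circ>\<^sub>F ?Eq) fid"
      by (simp add: functor_eq_def base_change_functor_def eq_functor_simps)
    show "u = amap ?Eq (amap Rel_fibration u)" if "u \<in> Hom ?R (omap ?Eq X) (omap ?Eq Y)" for X Y u
      using eq_functor_full[OF adj(2) that] by (simp add: base_change_functor_def)
  qed (use fib adj assms(8) in blast)+
  show ?thesis
    using is_lifting_lift eq_preserving_lift sound_coinduction_lift by blast
qed

end
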